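(* Let $n\ge k\ge 3$ be integers. A stick of unit length is broken at $n-1$ points chosen independently and uniformly at random, yielding $n$ segments. Then the probability that no choice of $k$ of the $n$ segments can form a $k$-gon is $$ \frac{n!}{\prod_{i=k-2}^{n} f_{k-1}(i)\;\prod_{\ell=2}^{k-2} h_{k-1}(\ell)}, $$ where the numbers $f_{k-1}(i)$ and $h_{k-1}(\ell)$ (the latter depending on $n$) are as defined in the context, and the product of the $h_{k-1}(\ell)$ is absent (equal to $1$) when $k=3$.
   Context: A collection of $k$ segments can form a $k$-gon if and only if the length of the longest one is less than the sum of the lengths of the other $k-1$ (generalized triangle inequality). For $r\ge 2$ the generalized Fibonacci numbers are $F^{(r)}_m=0$ for $0\le m\le r-2$, $F^{(r)}_{r-1}=1$, and $F^{(r)}_m=\sum_{i=1}^{r}F^{(r)}_{m-i}$ for $m\ge r$. Put $f_r(i)=0$ for $0\le i\le r-2$ and $f_r(i)=\sum_{m=r-1}^{i}F^{(r)}_m$ for $i\ge r-1$. For the fixed $n$, and with $r=k-1$, put $$g_{k-1}(j)=1+\sum_{\ell=2}^{j} f_{k-1}(n-\ell)\quad (2\le j\le k-2),\qquad h_{k-1}(\ell)=f_{k-1}(n)+\sum_{j=2}^{\ell} g_{k-1}(k-j)\quad (2\le \ell\le k-2).$$ *)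

theory Defs
  imports "HOL-Probability.Probability"
begin

fun gen_fib :: "nat \<Rightarrow> nat \<Rightarrow> nat" where
  "gen_fib r m =
     (if m < r - 1 then 0 else if m = r - 1 then 1 else (\<Sum>i=1..r. gen_fib r (m - i)))"

declare gen_fib.simps [simp del]

definition fib_sum :: "nat \<Rightarrow> nat \<Rightarrow> nat" where
  "fib_sum r i = (if i < r - 1 then 0 else (\<Sum>m=r-1..i. gen_fib r m))"

text \<open>
  \<open>g_num n k j\<close> and \<open>h_num n k l\<close> are the numbers $g_{k-1}(j)$ and $h_{k-1}(l)$, with their
  dependence on \<open>n\<close> made explicit. They are only meant for \<open>2 \<le> j \<le> k - 2\<close>,
  \<open>2 \<le> l \<le> k - 2\<close> and \<open>k \<le> n\<close>, where none of the subtractions is truncated.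
\<close>

definition g_num :: "nat \<Rightarrow> nat \<Rightarrow> nat \<Rightarrow> nat" where
  "g_num n k j = 1 + (\<Sum>l=2..j. fib_sum (k - 1) (n - l))"

definition h_num :: "nat \<Rightarrow> nat \<Rightarrow> nat \<Rightarrow> nat" where
  "h_num n k l = fib_sum (k - 1) n + (\<Sum>j=2..l. g_num n k (k - j))"

text \<open>
  The unit stick is \<open>[0, 1]\<close>, broken at the \<open>n - 1\<close> points \<open>x 1, \<dots>, x (n - 1)\<close>, which need not be
  in increasing order. Its \<open>n\<close> segments, from left to right, are numbered \<open>0, \<dots>, n - 1\<close>.
\<close>

definition cut_positions :: "nat \<Rightarrow> (nat \<Rightarrow> real) \<Rightarrow> real list" where
  "cut_positions n x = 0 # sort (map x [1..<n]) @ [1]"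

definition segment_length :: "nat \<Rightarrow> (nat \<Rightarrow> real) \<Rightarrow> nat \<Rightarrow> real" where
  "segment_length n x i = cut_positions n x ! Suc i - cut_positions n x ! i"

text \<open>
  Segments of lengths \<open>L i\<close>, \<open>i \<in> S\<close>, can form a polygon with \<open>card S\<close> sides: a longest one, \<open>m\<close>,
  is shorter than all others together. In case of ties the choice of \<open>m\<close> is immaterial.
\<close>

definition can_form_polygon :: "('i \<Rightarrow> real) \<Rightarrow> 'i set \<Rightarrow> bool" where
  "can_form_polygon L S \<longleftrightarrow>
     (\<exists>m\<in>S. (\<forall>i\<in>S. L i \<le> L m) \<and> L m < (\<Sum>i\<in>S - {m}. L i))"

end

theory Submission
  imports Defs "HOL-Combinatorics.Permutations"
begin

text \<open>
  Let $N$ be the set of positive vectors $y \in \mathbb{R}^n$ no $k$ of whose entries form a polygon.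
  It is invariant under scaling and permutations, and
  $I = \int_N e^{-(y_1 + \dots + y_n)}\,dy$ is evaluated in two ways.

  Substituting partial sums $s_i = y_1 + \dots + y_i$ and scaling by $s_n$ gives
  $I = (n-1)!$ times the volume of the set of increasing cut points in the unit stick with
  segments in $N$. By symmetry in the cut points this is the required probability.

  By symmetry in $y$, $I$ is $n!$ times the integral over the increasing vectors in $N$. These are
  described by $z_i = y_i - y_{i-1}$ being positive for $i < k$, and
  $z_i = y_i - (y_{i-1} + \dots + y_{i-k+1})$ being nonnegative for $i \ge k$. The map
  $y \mapsto z$ is unimodular and $\sum_i y_i = \sum_i c_i z_i$ for positive integers $c_i$, so
  $I = n! / \prod_i c_i$. The $c_i$ are the numbers $f_{k-1}(k-2), \dots, f_{k-1}(n)$ and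
  $h_{k-1}(2), \dots, h_{k-1}(k-2)$.
\<close>

section \<open>Lebesgue measure on finite sequences\<close>

text \<open>Points of this space are \<open>undefined\<close> outside \<open>{..<n}\<close>, which
  is why the transformations below are written with \<open>restrict\<close>.\<close>

abbreviation lborel_seq :: "nat \<Rightarrow> (nat \<Rightarrow> real) measure" where
  "lborel_seq n \<equiv> PiM {..<n} (\<lambda>_. lborel)"

interpretation lborel_seq: product_sigma_finite "\<lambda>_::nat. lborel :: real measure" ..

lemma borel_measurable_lborel_seq_component [measurable (raw)]:
  "i < n \<Longrightarrow> (\<lambda>x. x i) \<in> borel_measurable (lborel_seq n)"
  using measurable_component_singleton[of i "{..<n}" "\<lambda>_. lborel"] by simp

text \<open>By Tonelli one coordinate is treated at a time: the last one undergoes an affine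
  substitution whose shift depends only on earlier coordinates, so only the diagonal entries enter
  the Jacobian. Instances below are the passages to excesses and to partial sums, and
  scaling.\<close>

lemma nn_integral_lborel_seq_triangular:
  fixes a :: "nat \<Rightarrow> real"
  assumes "\<And>i. i < n \<Longrightarrow> a i \<noteq> 0"
    and "\<And>i. i < n \<Longrightarrow> \<phi> i \<in> borel_measurable (lborel_seq i)"
    and "f \<in> borel_measurable (lborel_seq n)"
  shows "(\<integral>\<^sup>+x. f x \<partial>lborel_seq n) =
    ennreal (\<Prod>i<n. \<bar>a i\<bar>) *
    (\<integral>\<^sup>+x. f (\<lambda>i\<in>{..<n}. a i * x i + \<phi> i (restrict x {..<i})) \<partial>lborel_seq n)"
  using assms
proof (induction n arbitrary: f)
  case 0
  show ?case
    by (simp add: space_PiM lborel_seq.nn_integral_empty)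
next
  case (Suc n)
  define T where "T x = (\<lambda>i\<in>{..<n}. a i * x i + \<phi> i (restrict x {..<i}))" for x
  have [measurable]: "(\<lambda>x. restrict x {..<i}) \<in> lborel_seq n \<rightarrow>\<^sub>M lborel_seq i" if "i < n" for i
    by (rule measurable_restrict_subset) (use that in auto)
  have [measurable]: "\<phi> i \<in> borel_measurable (lborel_seq i)" if "i < Suc n" for i
    using Suc.prems(2) that .
  have [measurable]: "T \<in> lborel_seq n \<rightarrow>\<^sub>M lborel_seq n"
    unfolding T_def
  proof (rule measurable_restrict)
    fix i assume "i \<in> {..<n}"
    then have "i < n" "i < Suc n" by auto
    note [measurable] = \<open>i < n\<close> \<open>i < Suc n\<close>
    have "(\<lambda>x. \<phi> i (restrict x {..<i})) \<in> borel_measurable (lborel_seq n)"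
      by (rule measurable_compose[where N="lborel_seq i"]) (use \<open>i < n\<close> in measurable)
    then show "(\<lambda>x. a i * x i + \<phi> i (restrict x {..<i})) \<in> lborel_seq n \<rightarrow>\<^sub>M lborel"
      by simp
  qed
  have ins: "{..<Suc n} = insert n {..<n}" by auto
  have [measurable]: "f \<in> borel_measurable (PiM (insert n {..<n}) (\<lambda>_. lborel))"
    using Suc.prems(3) by (simp add: ins)
  define g where "g x = (\<integral>\<^sup>+y. f (x(n := y)) \<partial>lborel)" for x
  have [measurable]: "g \<in> borel_measurable (lborel_seq n)"
    unfolding g_def by measurable
  have "(\<integral>\<^sup>+x. f x \<partial>lborel_seq (Suc n)) = (\<integral>\<^sup>+x. g x \<partial>lborel_seq n)"
    unfolding ins g_def by (subst lborel_seq.product_nn_integral_insert) auto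
  also have "\<dots> = ennreal (\<Prod>i<n. \<bar>a i\<bar>) * (\<integral>\<^sup>+x. g (T x) \<partial>lborel_seq n)"
    unfolding T_def by (rule Suc.IH) (use Suc.prems in auto)
  \<comment> \<open>The inner integral keeps \<open>x\<close> fixed, so its shift may be
    \<open>\<phi> n x\<close> with the untransformed \<open>x\<close>.\<close>
  also have "(\<integral>\<^sup>+x. g (T x) \<partial>lborel_seq n) =
    (\<integral>\<^sup>+x. ennreal \<bar>a n\<bar> * (\<integral>\<^sup>+y. f ((T x)(n := \<phi> n x + a n * y)) \<partial>lborel) \<partial>lborel_seq n)"
  proof (rule nn_integral_cong)
    fix x assume "x \<in> space (lborel_seq n)"
    then have "T x \<in> space (lborel_seq n)"
      by (rule measurable_space[OF \<open>T \<in> lborel_seq n \<rightarrow>\<^sub>M lborel_seq n\<close>])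
    note [measurable] = this
    have "(\<lambda>y. f ((T x)(n := y))) \<in> borel_measurable borel"
      by measurable
    then show "g (T x) = ennreal \<bar>a n\<bar> * (\<integral>\<^sup>+y. f ((T x)(n := \<phi> n x + a n * y)) \<partial>lborel)"
      unfolding g_def using Suc.prems(1) by (subst nn_integral_real_affine[of _ "a n" "\<phi> n x"]) auto
  qed
  also have "\<dots> = ennreal \<bar>a n\<bar> * (\<integral>\<^sup>+x. (\<integral>\<^sup>+y. f ((T x)(n := \<phi> n x + a n * y)) \<partial>lborel) \<partial>lborel_seq n)"
    by (rule nn_integral_cmult) measurable
  also have "(\<integral>\<^sup>+x. (\<integral>\<^sup>+y. f ((T x)(n := \<phi> n x + a n * y)) \<partial>lborel) \<partial>lborel_seq n) =
    (\<integral>\<^sup>+x. (\<integral>\<^sup>+y. f (\<lambda>i\<in>{..<Suc n}. a i * (x(n := y)) i + \<phi> i (restrict (x(n := y)) {..<i})) \<partial>lborel) \<partial>lborel_seq n)"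
  proof (intro nn_integral_cong arg_cong[where f=f])
    fix x y assume "x \<in> space (lborel_seq n)"
    \<comment> \<open>Since \<open>x\<close> is extensional, updating it at \<open>n\<close> and
      restricting again gives \<open>x\<close> back.\<close>
    then have "restrict (x(n := y)) {..<n} = x"
      by (auto simp: space_PiM PiE_def extensional_def fun_eq_iff)
    moreover have "restrict (x(n := y)) {..<i} = restrict x {..<i}" if "i < n" for i
      using that by (auto simp: fun_eq_iff)
    ultimately show "(T x)(n := \<phi> n x + a n * y) =
      (\<lambda>i\<in>{..<Suc n}. a i * (x(n := y)) i + \<phi> i (restrict (x(n := y)) {..<i}))"
      by (intro ext) (simp add: T_def less_Suc_eq)
  qed
  also have "\<dots> = (\<integral>\<^sup>+x. f (\<lambda>i\<in>{..<Suc n}. a i * x i + \<phi> i (restrict x {..<i})) \<partial>lborel_seq (Suc n))"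
  proof -
    have "(\<lambda>x. \<lambda>i\<in>{..<Suc n}. a i * x i + \<phi> i (restrict x {..<i})) \<in> lborel_seq (Suc n) \<rightarrow>\<^sub>M lborel_seq (Suc n)"
    proof (rule measurable_restrict)
      fix i assume "i \<in> {..<Suc n}"
      have [measurable]: "(\<lambda>x. \<phi> i (restrict x {..<i})) \<in> borel_measurable (lborel_seq (Suc n))"
        by (rule measurable_compose[where N="lborel_seq i"], rule measurable_restrict_subset)
           (use \<open>i \<in> _\<close> Suc.prems(2) in auto)
      show "(\<lambda>x. a i * x i + \<phi> i (restrict x {..<i})) \<in> lborel_seq (Suc n) \<rightarrow>\<^sub>M lborel"
        using \<open>i \<in> _\<close> by simp
    qed
    note [measurable] = this[unfolded ins]
    show ?thesis
      unfolding ins by (subst lborel_seq.product_nn_integral_insert) auto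
  qed
  also have "ennreal (\<Prod>i<n. \<bar>a i\<bar>) * (ennreal \<bar>a n\<bar> * I) = ennreal (\<Prod>i<Suc n. \<bar>a i\<bar>) * I" for I
    by (simp add: ennreal_mult prod_nonneg mult.assoc)
  finally show ?case .
qed

section \<open>Invariance under permutations of the coordinates\<close>

lemma measurable_permute_lborel_seq:
  assumes \<sigma>: "\<sigma> permutes {..<n}"
  shows "(\<lambda>x. x \<circ> \<sigma>) \<in> lborel_seq n \<rightarrow>\<^sub>M lborel_seq n"
proof (rule measurable_PiM_single')
  fix i assume "i \<in> {..<n}"
  then have "\<sigma> i \<in> {..<n}" using permutes_in_image[OF \<sigma>] by simp
  then show "(\<lambda>x. (x \<circ> \<sigma>) i) \<in> lborel_seq n \<rightarrow>\<^sub>M lborel"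
    using measurable_component_singleton[of "\<sigma> i" "{..<n}" "\<lambda>_. lborel"] by simp
next
  show "(\<lambda>x. x \<circ> \<sigma>) \<in> space (lborel_seq n) \<rightarrow> ({..<n} \<rightarrow>\<^sub>E space lborel)"
    using permutes_not_in[OF \<sigma>] by (auto simp: space_PiM PiE_def extensional_def)
qed

text \<open>Boxes determine the product measure. The preimage of a box is the box with sides
  permuted by \<open>inv \<sigma>\<close>, and its volume is the same product in another
  order.\<close>

lemma nn_integral_lborel_seq_permute:
  assumes \<sigma>: "\<sigma> permutes {..<n}" and f: "f \<in> borel_measurable (lborel_seq n)"
  shows "(\<integral>\<^sup>+x. f (x \<circ> \<sigma>) \<partial>lborel_seq n) = (\<integral>\<^sup>+x. f x \<partial>lborel_seq n)"
proof -
  let ?L = "lborel_seq n"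
  note m = measurable_permute_lborel_seq[OF \<sigma>]
  have "distr ?L ?L (\<lambda>x. x \<circ> \<sigma>) = ?L"
  proof (rule lborel_seq.PiM_eqI)
    fix A :: "nat \<Rightarrow> real set" assume A: "\<And>i. i \<in> {..<n} \<Longrightarrow> A i \<in> sets lborel"
    have inv: "inv \<sigma> permutes {..<n}" using \<sigma> by (rule permutes_inv)
    have pre: "(\<lambda>x. x \<circ> \<sigma>) -` Pi\<^sub>E {..<n} A \<inter> space ?L = Pi\<^sub>E {..<n} (A \<circ> inv \<sigma>)"
      (is "?l = ?r")
    proof (intro set_eqI iffI)
      fix x assume x: "x \<in> ?l"
      show "x \<in> ?r"
      proof (rule PiE_I)
        fix i assume i: "i \<in> {..<n}"
        then have "inv \<sigma> i \<in> {..<n}" using permutes_in_image[OF inv] by simp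
        then have "(x \<circ> \<sigma>) (inv \<sigma> i) \<in> A (inv \<sigma> i)"
          using x by (auto simp: PiE_iff)
        then show "x i \<in> (A \<circ> inv \<sigma>) i"
          using permutes_inverses(1)[OF \<sigma>] by simp
      next
        fix i assume "i \<notin> {..<n}"
        then show "x i = undefined" using x by (auto simp: space_PiM PiE_def extensional_def)
      qed
    next
      fix x assume x: "x \<in> ?r"
      have "x \<circ> \<sigma> \<in> Pi\<^sub>E {..<n} A"
      proof (rule PiE_I)
        fix i assume i: "i \<in> {..<n}"
        then have "\<sigma> i \<in> {..<n}" using permutes_in_image[OF \<sigma>] by simp
        then have "x (\<sigma> i) \<in> (A \<circ> inv \<sigma>) (\<sigma> i)"
          using x by (auto simp: PiE_iff)
        then show "(x \<circ> \<sigma>) i \<in> A i"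
          using permutes_inverses(2)[OF \<sigma>] by simp
      next
        fix i assume "i \<notin> {..<n}"
        then show "(x \<circ> \<sigma>) i = undefined"
          using x permutes_not_in[OF \<sigma>] by (auto simp: PiE_def extensional_def)
      qed
      then show "x \<in> ?l" using x by (auto simp: space_PiM PiE_def extensional_def)
    qed
    have A': "(A \<circ> inv \<sigma>) i \<in> sets lborel" if "i \<in> {..<n}" for i
      using A permutes_in_image[OF inv] that by simp
    have "emeasure (distr ?L ?L (\<lambda>x. x \<circ> \<sigma>)) (Pi\<^sub>E {..<n} A) = emeasure ?L (Pi\<^sub>E {..<n} (A \<circ> inv \<sigma>))"
      using A by (subst emeasure_distr[OF m]) (auto simp: pre intro!: sets_PiM_I_finite)
    also have "\<dots> = (\<Prod>i\<in>{..<n}. emeasure lborel ((A \<circ> inv \<sigma>) i))"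
      by (rule lborel_seq.emeasure_PiM) (use A' in auto)
    also have "\<dots> = (\<Prod>i\<in>{..<n}. emeasure lborel (A i))"
      using prod.permute[OF inv, of "\<lambda>i. emeasure lborel (A i)"] by (simp add: o_def)
    finally show "emeasure (distr ?L ?L (\<lambda>x. x \<circ> \<sigma>)) (Pi\<^sub>E {..<n} A) = (\<Prod>i\<in>{..<n}. emeasure lborel (A i))" .
  qed auto
  then have "(\<integral>\<^sup>+x. f x \<partial>?L) = (\<integral>\<^sup>+x. f x \<partial>distr ?L ?L (\<lambda>x. x \<circ> \<sigma>))" by simp
  also have "\<dots> = (\<integral>\<^sup>+x. f (x \<circ> \<sigma>) \<partial>?L)"
    by (rule nn_integral_distr[OF m]) (use f in simp)
  finally show ?thesis by simp
qed

text \<open>For distinct \<open>i\<close> and \<open>j\<close>, the slice of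
  \<open>x i = x j\<close> in direction \<open>i\<close> is a single point, hence null. Only
  finitely many pairs occur.\<close>

lemma AE_lborel_seq_inj_on: "AE x in lborel_seq n. inj_on x {..<n}"
proof -
  have *: "AE x in lborel_seq n. x i \<noteq> x j" if ij: "i < n" "j < n" "i \<noteq> j" for i j
  proof -
    let ?I = "{..<n} - {i}"
    have ins: "{..<n} = insert i ?I" using ij by auto
    have mi[measurable]: "(\<lambda>x. x i) \<in> borel_measurable (PiM (insert i ?I) (\<lambda>_. lborel))"
      using measurable_component_singleton[of i "insert i ?I" "\<lambda>_. lborel"] by simp
    have mj[measurable]: "(\<lambda>x. x j) \<in> borel_measurable (PiM (insert i ?I) (\<lambda>_. lborel))"
      using measurable_component_singleton[of j "insert i ?I" "\<lambda>_. lborel"] ij by simp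
    define f :: "(nat \<Rightarrow> real) \<Rightarrow> ennreal" where "f x = (if x i = x j then 1 else 0)" for x
    have f: "f \<in> borel_measurable (PiM (insert i ?I) (\<lambda>_. lborel))"
      unfolding f_def by measurable
    have "(\<integral>\<^sup>+x. f x \<partial>PiM (insert i ?I) (\<lambda>_. lborel)) =
      (\<integral>\<^sup>+x. (\<integral>\<^sup>+y. f (x(i := y)) \<partial>lborel) \<partial>PiM ?I (\<lambda>_. lborel))"
      by (rule lborel_seq.product_nn_integral_insert[OF _ _ f]) auto
    also have "\<dots> = (\<integral>\<^sup>+x. (\<integral>\<^sup>+y. indicator {x j :: real} y \<partial>lborel) \<partial>PiM ?I (\<lambda>_. lborel))"
      using ij by (intro nn_integral_cong) (auto simp: indicator_def f_def)
    also have "\<dots> = 0" by simp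
    finally have "AE x in PiM (insert i ?I) (\<lambda>_. lborel). f x = 0"
      by (subst (asm) nn_integral_0_iff_AE[OF f])
    then show ?thesis
      unfolding ins[symmetric] by eventually_elim (auto simp: f_def split: if_splits)
  qed
  have "AE x in lborel_seq n. \<forall>i\<in>{..<n}. \<forall>j\<in>{..<n}. i \<noteq> j \<longrightarrow> x i \<noteq> x j"
    using * by (intro AE_finite_allI) auto
  then show ?thesis
    by eventually_elim (auto simp: inj_on_def)
qed

section \<open>Sorting permutations and symmetric integrands\<close>

lemma sorting_permutation_exists:
  fixes x :: "nat \<Rightarrow> 'a::linorder"
  obtains \<sigma> where "\<sigma> permutes {..<n}" "mono_on {..<n} (x \<circ> \<sigma>)"
proof -
  obtain \<sigma> where \<sigma>: "\<sigma> permutes {..<length (map x [0..<n])}"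
      "permute_list \<sigma> (map x [0..<n]) = sort (map x [0..<n])"
    by (rule mset_eq_permutation[of "sort (map x [0..<n])" "map x [0..<n]"]) auto
  have "sort (map x [0..<n]) ! i = x (\<sigma> i)" if "i < n" for i
  proof -
    have "\<sigma> i < n" using permutes_in_image[OF \<sigma>(1), of i] that by simp
    then show ?thesis using that by (simp flip: \<sigma>(2) add: permute_list_def)
  qed
  then have "mono_on {..<n} (x \<circ> \<sigma>)"
    using sorted_nth_mono[OF sorted_sort[of "map x [0..<n]"]] by (auto intro!: mono_onI)
  with \<sigma>(1) that show thesis by simp
qed

lemma mset_map_permute:
  assumes "\<sigma> permutes {..<n}"
  shows "mset (map (x \<circ> \<sigma>) [0..<n]) = mset (map x [0..<n])"
proof -
  have "image_mset \<sigma> (mset_set {..<n}) = mset_set {..<n}"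
    using assms by (simp add: image_mset_mset_set permutes_inj_on permutes_image)
  then have "image_mset x (image_mset \<sigma> (mset_set {..<n})) = image_mset x (mset_set {..<n})" by simp
  then show ?thesis
    by (simp add: multiset.map_comp lessThan_atLeast0)
qed

lemma sort_map_eq_if_mono_on:
  fixes x :: "nat \<Rightarrow> 'a::linorder"
  assumes "\<sigma> permutes {..<n}" "mono_on {..<n} (x \<circ> \<sigma>)"
  shows "sort (map x [0..<n]) = map (x \<circ> \<sigma>) [0..<n]"
proof (rule properties_for_sort)
  show "mset (map (x \<circ> \<sigma>) [0..<n]) = mset (map x [0..<n])"
    using assms(1) by (rule mset_map_permute)
  show "sorted (map (x \<circ> \<sigma>) [0..<n])"
    using assms(2) by (auto simp: sorted_iff_nth_mono_less mono_on_def)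
qed

text \<open>Without ties a sorted arrangement is strictly increasing. Two such arrangements both
  equal the sorted list, and injectivity cancels \<open>x\<close>.\<close>

lemma ex1_sorting_permutation:
  fixes x :: "nat \<Rightarrow> 'a::linorder"
  assumes x: "inj_on x {..<n}"
  shows "\<exists>!\<sigma>. \<sigma> permutes {..<n} \<and> strict_mono_on {..<n} (x \<circ> \<sigma>)"
proof (rule ex_ex1I)
  obtain \<sigma> where \<sigma>: "\<sigma> permutes {..<n}" "mono_on {..<n} (x \<circ> \<sigma>)"
    by (rule sorting_permutation_exists)
  have "inj_on (x \<circ> \<sigma>) {..<n}"
    using x \<sigma>(1) by (simp add: comp_inj_on_iff[symmetric] permutes_inj_on permutes_image)
  then have "strict_mono_on {..<n} (x \<circ> \<sigma>)"
    using mono_onD[OF \<sigma>(2)] by (intro strict_mono_onI order.not_eq_order_implies_strict)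
      (auto simp: inj_on_def)
  with \<sigma>(1) show "\<exists>\<sigma>. \<sigma> permutes {..<n} \<and> strict_mono_on {..<n} (x \<circ> \<sigma>)" by blast
next
  fix \<sigma> \<tau>
  assume "\<sigma> permutes {..<n} \<and> strict_mono_on {..<n} (x \<circ> \<sigma>)"
    and "\<tau> permutes {..<n} \<and> strict_mono_on {..<n} (x \<circ> \<tau>)"
  then have \<sigma>: "\<sigma> permutes {..<n}" and \<tau>: "\<tau> permutes {..<n}"
    and eq: "map (x \<circ> \<sigma>) [0..<n] = map (x \<circ> \<tau>) [0..<n]"
    using sort_map_eq_if_mono_on[of \<sigma> n x] sort_map_eq_if_mono_on[of \<tau> n x]
    by (simp_all add: strict_mono_on_imp_mono_on)
  show "\<sigma> = \<tau>"
  proof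
    fix i
    show "\<sigma> i = \<tau> i"
    proof (cases "i < n")
      case True
      then have "x (\<sigma> i) = x (\<tau> i)" using eq by simp
      then show ?thesis
        using x True permutes_in_image[OF \<sigma>] permutes_in_image[OF \<tau>] by (auto simp: inj_on_def)
    next
      case False
      then show ?thesis using permutes_not_in[OF \<sigma>] permutes_not_in[OF \<tau>] by simp
    qed
  qed
qed

lemma pred_strict_mono_on_lborel_seq [measurable]:
  "Measurable.pred (lborel_seq n) (strict_mono_on {..<n})"
proof -
  have "Measurable.pred (lborel_seq n) (\<lambda>x. \<forall>i\<in>{..<n}. \<forall>j\<in>{..<n}. i < j \<longrightarrow> x i < x j)"
    by (intro pred_intros_finite) auto
  then show ?thesis by (simp add: strict_mono_on_def[abs_def] Ball_def conj_commute imp_conjL)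
qed

text \<open>Almost everywhere exactly one of the \<open>n!\<close> rearrangements of
  \<open>x\<close> is strictly increasing. Thus \<open>f\<close> is the sum of \<open>n!\<close>
  rearranged copies of its restriction to increasing vectors, all with the same integral. Applied
  both to segment lengths and to cut points.\<close>

lemma nn_integral_lborel_seq_symmetric:
  assumes f: "f \<in> borel_measurable (lborel_seq n)"
    and sym: "\<And>\<sigma> x. \<sigma> permutes {..<n} \<Longrightarrow> f (x \<circ> \<sigma>) = f x"
  shows "(\<integral>\<^sup>+x. f x \<partial>lborel_seq n) =
    fact n * (\<integral>\<^sup>+x. f x * indicator {x. strict_mono_on {..<n} x} x \<partial>lborel_seq n)"
proof -
  let ?P = "{\<sigma>. \<sigma> permutes {..<n}}"
  define g where "g x = f x * indicator {x. strict_mono_on {..<n} x} x" for x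
  have g[measurable]: "g \<in> borel_measurable (lborel_seq n)"
    unfolding g_def using f by simp
  have "AE x in lborel_seq n. f x = (\<Sum>\<sigma>\<in>?P. g (x \<circ> \<sigma>))"
    using AE_lborel_seq_inj_on
  proof eventually_elim
    case (elim x)
    from ex1_sorting_permutation[OF elim] obtain \<sigma> where \<sigma>: "\<sigma> permutes {..<n}"
      "strict_mono_on {..<n} (x \<circ> \<sigma>)"
      "\<And>\<tau>. \<tau> permutes {..<n} \<Longrightarrow> strict_mono_on {..<n} (x \<circ> \<tau>) \<Longrightarrow> \<tau> = \<sigma>" by blast
    have "(\<Sum>\<tau>\<in>?P. g (x \<circ> \<tau>)) = (\<Sum>\<tau>\<in>?P. if \<tau> = \<sigma> then f x else 0)"
      using \<sigma>(2) by (intro sum.cong) (auto simp: g_def sym indicator_def dest: \<sigma>(3))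
    also have "\<dots> = f x" using \<sigma>(1) by (simp add: finite_permutations)
    finally show ?case by simp
  qed
  then have "(\<integral>\<^sup>+x. f x \<partial>lborel_seq n) = (\<integral>\<^sup>+x. (\<Sum>\<sigma>\<in>?P. g (x \<circ> \<sigma>)) \<partial>lborel_seq n)"
    by (rule nn_integral_cong_AE)
  also have "\<dots> = (\<Sum>\<sigma>\<in>?P. \<integral>\<^sup>+x. g (x \<circ> \<sigma>) \<partial>lborel_seq n)"
    by (rule nn_integral_sum) (auto intro: measurable_compose[OF measurable_permute_lborel_seq g])
  also have "\<dots> = (\<Sum>\<sigma>\<in>?P. \<integral>\<^sup>+x. g x \<partial>lborel_seq n)"
    by (intro sum.cong refl nn_integral_lborel_seq_permute) auto
  also have "\<dots> = fact n * (\<integral>\<^sup>+x. g x \<partial>lborel_seq n)"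
    by (simp add: card_permutations)
  finally show ?thesis by (simp add: g_def)
qed

section \<open>Sequences of lengths without polygons\<close>

definition no_polygon :: "nat \<Rightarrow> nat \<Rightarrow> (nat \<Rightarrow> real) \<Rightarrow> bool" where
  "no_polygon n k L \<longleftrightarrow> (\<forall>S. S \<subseteq> {0..<n} \<and> card S = k \<longrightarrow> \<not> can_form_polygon L S)"

lemma can_form_polygon_cong:
  assumes "\<And>i. i \<in> S \<Longrightarrow> L i = L' i"
  shows "can_form_polygon L S \<longleftrightarrow> can_form_polygon L' S"
proof -
  have "sum L (S - {m}) = sum L' (S - {m})" for m
    using assms by (intro sum.cong) auto
  then show ?thesis using assms by (simp add: can_form_polygon_def cong: bex_cong ball_cong)
qed

lemma no_polygon_cong:
  assumes "\<And>i. i < n \<Longrightarrow> L i = L' i"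
  shows "no_polygon n k L \<longleftrightarrow> no_polygon n k L'"
proof -
  have "can_form_polygon L S \<longleftrightarrow> can_form_polygon L' S" if "S \<subseteq> {0..<n}" for S
    using assms that by (intro can_form_polygon_cong) auto
  then show ?thesis by (auto simp: no_polygon_def)
qed

lemma can_form_polygon_image:
  assumes "inj_on \<sigma> S"
  shows "can_form_polygon L (\<sigma> ` S) \<longleftrightarrow> can_form_polygon (L \<circ> \<sigma>) S"
proof -
  have "sum L (\<sigma> ` S - {\<sigma> m}) = sum (L \<circ> \<sigma>) (S - {m})" if "m \<in> S" for m
  proof -
    have "\<sigma> ` S - {\<sigma> m} = \<sigma> ` (S - {m})"
      using assms that by (auto simp: inj_on_def)
    then show ?thesis
      using assms by (simp add: sum.reindex inj_on_diff)
  qed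
  then show ?thesis
    unfolding can_form_polygon_def bex_simps ball_simps by (auto cong: bex_cong)
qed

lemma no_polygon_permute:
  assumes \<sigma>: "\<sigma> permutes {..<n}"
  shows "no_polygon n k (L \<circ> \<sigma>) \<longleftrightarrow> no_polygon n k L"
proof -
  have imp: "no_polygon n k (L \<circ> \<tau>)" if \<tau>: "\<tau> permutes {..<n}" and L: "no_polygon n k L" for L \<tau>
    unfolding no_polygon_def
  proof (intro allI impI)
    fix S assume S: "S \<subseteq> {0..<n} \<and> card S = k"
    have "inj_on \<tau> S" by (rule permutes_inj_on[OF \<tau>])
    moreover have "\<tau> ` S \<subseteq> {0..<n}"
      using S permutes_in_image[OF \<tau>] by auto
    ultimately show "\<not> can_form_polygon (L \<circ> \<tau>) S"
      using L S by (simp add: no_polygon_def card_image flip: can_form_polygon_image)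
  qed
  \<comment> \<open>The converse direction is \<open>imp\<close> for the inverse
    permutation.\<close>
  have "L = (L \<circ> \<sigma>) \<circ> inv \<sigma>"
    using permutes_inv_o[OF \<sigma>] by (simp add: comp_assoc)
  then show ?thesis
    using imp[OF \<sigma>, of L] imp[OF permutes_inv[OF \<sigma>], of "L \<circ> \<sigma>"] by auto
qed

lemma no_polygon_scale:
  assumes "0 < c"
  shows "no_polygon n k (\<lambda>i. c * L i) \<longleftrightarrow> no_polygon n k L"
  using assms by (simp add: no_polygon_def can_form_polygon_def flip: sum_distrib_left)

text \<open>Exchange argument: the indices of \<open>T\<close> outside the window lie below
  \<open>m - r\<close>, the window indices missing from \<open>T\<close> lie at or above it, and
  there are equally many of both, so \<open>L (m - r)\<close> separates the two sums. The case
  \<open>r = 0\<close> is split off because \<open>m - r\<close> would leave the domain of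
  monotonicity.\<close>

lemma sum_le_sum_last:
  fixes L :: "nat \<Rightarrow> 'a::ordered_semiring_1"
  assumes mono: "mono_on {..<m} L" and T: "T \<subseteq> {..<m}" "card T = r"
  shows "sum L T \<le> sum L {m - r..<m}"
proof (cases "r = 0")
  case True
  then have "T = {}" using T finite_subset[OF T(1)] by simp
  then show ?thesis using True by simp
next
  case False
  have fT: "finite T" using T(1) finite_subset by blast
  have rm: "r \<le> m" using card_mono[OF _ T(1)] T(2) by simp
  let ?W = "{m - r..<m}"
  have "card (T - ?W) + card (T \<inter> ?W) = r"
    using T(2) card_Int_Diff[OF fT, of ?W] by simp
  moreover have "card (?W - T) + card (T \<inter> ?W) = r"
    using card_Int_Diff[of ?W T] rm by (simp add: Int_commute)
  ultimately have card: "card (T - ?W) = card (?W - T)" by simp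
  have "sum L (T - ?W) \<le> of_nat (card (T - ?W)) * L (m - r)"
    using T(1) False rm by (intro sum_bounded_above monotone_onD[OF mono]) auto
  also have "\<dots> \<le> sum L (?W - T)"
    unfolding card using False rm by (intro sum_bounded_below monotone_onD[OF mono]) auto
  finally have "sum L (T - ?W) + sum L (T \<inter> ?W) \<le> sum L (?W - T) + sum L (T \<inter> ?W)"
    by (rule add_right_mono)
  moreover have "sum L T = sum L (T - ?W) + sum L (T \<inter> ?W)"
    using sum.Int_Diff[OF fT, of L ?W] by (simp add: add.commute)
  moreover have "sum L ?W = sum L (?W - T) + sum L (T \<inter> ?W)"
    using sum.Int_Diff[of ?W L T] by (simp add: add.commute Int_commute)
  ultimately show ?thesis by simp
qed

text \<open>Among the sets of \<open>r + 1\<close> segments with a given longest one, consecutive segments are the worst case.\<close>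

lemma no_polygon_strict_mono_iff:
  assumes L: "strict_mono_on {..<n} L"
  shows "no_polygon n (Suc r) L \<longleftrightarrow> (\<forall>i\<in>{r..<n}. sum L {i - r..<i} \<le> L i)"
proof
  assume np: "no_polygon n (Suc r) L"
  show "\<forall>i\<in>{r..<n}. sum L {i - r..<i} \<le> L i"
  proof
    fix i assume i: "i \<in> {r..<n}"
    let ?S = "{i - r..i}"
    have "?S \<subseteq> {0..<n} \<and> card ?S = Suc r" using i by auto
    then have "\<not> can_form_polygon L ?S" using np by (simp add: no_polygon_def)
    moreover have "\<forall>j\<in>?S. L j \<le> L i"
      using i strict_mono_on_leD[OF L] by auto
    moreover have "?S - {i} = {i - r..<i}" by auto
    ultimately show "sum L {i - r..<i} \<le> L i"
      unfolding can_form_polygon_def by (metis atLeastAtMost_iff diff_le_self order_refl not_le)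
  qed
next
  assume win: "\<forall>i\<in>{r..<n}. sum L {i - r..<i} \<le> L i"
  show "no_polygon n (Suc r) L"
    unfolding no_polygon_def can_form_polygon_def
  proof (intro allI impI notI)
    fix S assume S: "S \<subseteq> {0..<n} \<and> card S = Suc r"
    assume "\<exists>m\<in>S. (\<forall>i\<in>S. L i \<le> L m) \<and> L m < sum L (S - {m})"
    then obtain m where m: "m \<in> S" "\<forall>i\<in>S. L i \<le> L m" "L m < sum L (S - {m})" by blast
    have "m < n" using S m(1) by auto
    have sub: "S - {m} \<subseteq> {..<m}"
    proof
      fix i assume i: "i \<in> S - {m}"
      show "i \<in> {..<m}"
      proof (rule ccontr)
        assume "i \<notin> {..<m}"
        then have "m < i" "i < n" using i S by auto
        then have "L m < L i" using strict_mono_onD[OF L] \<open>m < n\<close> by simp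
        then show False using m(2) i by force
      qed
    qed
    have card: "card (S - {m}) = r" using S m(1) by simp
    then have "r \<le> m" using card_mono[OF _ sub] by simp
    have "mono_on {..<m} L"
      using L \<open>m < n\<close> by (intro strict_mono_on_imp_mono_on monotone_on_subset[OF L]) auto
    from sum_le_sum_last[OF this sub card] have "sum L (S - {m}) \<le> sum L {m - r..<m}" .
    also have "\<dots> \<le> L m" using win \<open>r \<le> m\<close> \<open>m < n\<close> by simp
    finally show False using m(3) by simp
  qed
qed

text \<open>
  For a sorted sequence \<open>y\<close> and \<open>k = r + 1\<close>, the \<open>i\<close>-th excess compares \<open>y i\<close> with the \<open>r\<close> preceding
  terms if these exist (the polygon condition), and with the single preceding one otherwise
  (sortedness). The truncated subtraction makes the window of index \<open>0\<close> empty.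
\<close>

definition prev_window :: "nat \<Rightarrow> nat \<Rightarrow> nat set" where
  "prev_window r i = {(if i < r then i - 1 else i - r)..<i}"

definition excess :: "nat \<Rightarrow> (nat \<Rightarrow> real) \<Rightarrow> nat \<Rightarrow> real" where
  "excess r y i = y i - sum y (prev_window r i)"

text \<open>The first \<open>r\<close> excesses encode positivity and increase, the later ones the
  polygon condition. Strict increase from index \<open>r\<close> on comes for free: a sum of at
  least two consecutive positive terms exceeds the last of them.\<close>

lemma sorted_no_polygon_iff_excess:
  assumes r: "2 \<le> r"
  shows "strict_mono_on {..<n} y \<and> (\<forall>i<n. 0 < y i) \<and> no_polygon n (Suc r) y \<longleftrightarrow>
    (\<forall>i<n. if i < r then 0 < excess r y i else 0 \<le> excess r y i)"
proof
  assume y: "strict_mono_on {..<n} y \<and> (\<forall>i<n. 0 < y i) \<and> no_polygon n (Suc r) y"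
  show "\<forall>i<n. if i < r then 0 < excess r y i else 0 \<le> excess r y i"
  proof (intro allI impI)
    fix i assume i: "i < n"
    consider "i = 0" | j where "i = Suc j" "i < r" | "r \<le> i"
      by (metis not_less not0_implies_Suc)
    then show "if i < r then 0 < excess r y i else 0 \<le> excess r y i"
    proof cases
      case 1
      then show ?thesis using y i r by (simp add: excess_def prev_window_def)
    next
      case 2
      then show ?thesis using y i by (auto simp: excess_def prev_window_def strict_mono_on_def)
    next
      case 3
      then show ?thesis
        using y i no_polygon_strict_mono_iff[of n y r] by (simp add: excess_def prev_window_def)
    qed
  qed
next
  assume z: "\<forall>i<n. if i < r then 0 < excess r y i else 0 \<le> excess r y i"
  have step: "0 < y i \<and> (\<forall>j<i. y j < y i)" if "i < n" for i
    using that
  proof (induction i rule: less_induct)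
    case (less i)
    show ?case
    proof (cases "i = 0")
      case True
      then show ?thesis using z less.prems r by (auto simp: excess_def prev_window_def)
    next
      case False
      then obtain j where j: "i = Suc j" by (cases i) auto
      have IH: "0 < y l" "l' < l \<Longrightarrow> y l' < y l" if "l < i" for l l'
        using less.IH[of l] less.prems that by auto
      have "y j < y i"
      proof (cases "i < r")
        case True
        then show ?thesis using z less.prems j by (auto simp: excess_def prev_window_def)
      next
        case False
        \<comment> \<open>As \<open>2 \<le> r \<le> i\<close>, both \<open>j - 1\<close> and
          \<open>j\<close> lie in the window, and \<open>y (j - 1)\<close> is positive.\<close>
        have "y j < sum y {j - 1, j}"
          using IH(1)[of "j - 1"] j False r by (cases j) auto
        also have "\<dots> \<le> sum y {i - r..<i}"
          using False r j IH(1) by (intro sum_mono2) (auto intro: less_imp_le)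
        also have "\<dots> \<le> y i"
          using z less.prems False by (auto simp: excess_def prev_window_def)
        finally show ?thesis .
      qed
      moreover have "0 < y j" using IH(1) j by simp
      moreover have "y l \<le> y j" if "l < i" for l
        using IH(2)[of j l] that j by (cases "l = j") auto
      ultimately show ?thesis by fastforce
    qed
  qed
  then have sm: "strict_mono_on {..<n} y" by (auto intro: strict_mono_onI)
  moreover have "no_polygon n (Suc r) y"
    unfolding no_polygon_strict_mono_iff[OF sm]
    using z by (auto simp: excess_def prev_window_def)
  ultimately show "strict_mono_on {..<n} y \<and> (\<forall>i<n. 0 < y i) \<and> no_polygon n (Suc r) y"
    using step by blast
qed

section \<open>Generalized Fibonacci sums and the coefficients of the total length\<close>

lemma gen_fib_eq_0: "m < r - 1 \<Longrightarrow> gen_fib r m = 0"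
  by (subst gen_fib.simps) simp

lemma fib_sum_eq_0: "i < r - 1 \<Longrightarrow> fib_sum r i = 0"
  by (simp add: fib_sum_def)

lemma fib_sum_Suc: "fib_sum r (Suc i) = fib_sum r i + gen_fib r (Suc i)"
  by (cases "Suc i = r - 1") (auto simp: fib_sum_def gen_fib_eq_0)

text \<open>Summation of the recursion for \<open>gen_fib\<close>; the constant 1 is the initial
  value \<open>gen_fib r (r - 1)\<close>. In this form it matches \<open>weight_rec\<close>.\<close>

lemma fib_sum_rec:
  assumes "2 \<le> r" "r - 1 \<le> a"
  shows "fib_sum r a = 1 + (\<Sum>i=1..r. fib_sum r (a - i))"
  using assms(2)
proof (induction a rule: nat_induct_at_least)
  case base
  have "gen_fib r (r - 1) = 1" by (subst gen_fib.simps) simp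
  moreover have "(\<Sum>i=1..r. fib_sum r (r - 1 - i)) = 0"
    using assms(1) by (auto simp: fib_sum_eq_0)
  ultimately show ?case by (simp add: fib_sum_def)
next
  case (Suc a)
  have "gen_fib r (Suc a) = (\<Sum>i=1..r. gen_fib r (Suc a - i))"
    using Suc.hyps assms(1) by (subst gen_fib.simps) auto
  moreover have "fib_sum r (Suc a - i) = fib_sum r (a - i) + gen_fib r (Suc a - i)"
    if "i \<in> {1..r}" for i
  proof (cases "i \<le> a")
    case True
    then show ?thesis by (simp add: Suc_diff_le fib_sum_Suc)
  next
    \<comment> \<open>Both \<open>a - i\<close> and \<open>Suc a - i\<close> are truncated to 0,
      where \<open>gen_fib r\<close> vanishes because \<open>2 \<le> r\<close>.\<close>
    case False
    then show ?thesis using assms(1) by (simp add: gen_fib_eq_0)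
  qed
  then have "(\<Sum>i=1..r. fib_sum r (Suc a - i)) =
      (\<Sum>i=1..r. fib_sum r (a - i)) + (\<Sum>i=1..r. gen_fib r (Suc a - i))"
    by (simp add: sum.distrib)
  ultimately show ?case
    using Suc.IH by (simp add: fib_sum_Suc)
qed

lemma h_num_Suc:
  assumes "1 \<le> l"
  shows "h_num n k (Suc l) = h_num n k l + g_num n k (k - Suc l)"
  using assms by (simp add: h_num_def)

text \<open>
  With \<open>r = k - 1\<close>, these are the coefficients of the total length as a linear form in the excesses,
  see \<open>sum_weight_excess\<close> below.
\<close>

definition weight :: "nat \<Rightarrow> nat \<Rightarrow> nat \<Rightarrow> nat" where
  "weight n r i = (if r \<le> i + 2 then fib_sum r (n + r - 2 - i) else h_num n (Suc r) (r - 1 - i))"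

lemma weight_pos:
  assumes "2 \<le> r" "r < n" "i < n"
  shows "0 < weight n r i"
  using assms by (auto simp: weight_def h_num_def fib_sum_rec)

text \<open>Comparing coefficients of \<open>y j\<close> in \<open>sum_weight_excess\<close> forces
  this recursion. For \<open>j \<ge> r - 2\<close> it is \<open>fib_sum_rec\<close>; below that each
  step adds one \<open>g_num\<close>, the increment of \<open>h_num\<close>.\<close>

lemma weight_rec:
  assumes r: "2 \<le> r" "r < n" and j: "j < n"
  shows "weight n r j = 1 + (\<Sum>i | i < n \<and> j \<in> prev_window r i. weight n r i)"
proof -
  let ?A = "{i. j \<in> prev_window r i}"
  \<comment> \<open>The first piece comes from a one-element window used for sortedness, the second
    from the windows of length \<open>r\<close>.\<close>
  have A: "?A = (if Suc j < r then {Suc j} else {}) \<union> {max (Suc j) r..j + r}"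
    using r by (auto simp: prev_window_def split: if_splits)
  \<comment> \<open>Vanishing weights past the end allow the bound \<open>i < n\<close> to be
    dropped from the sum.\<close>
  have zero: "weight n r i = 0" if "n \<le> i" for i
    using that r by (auto simp: weight_def intro!: fib_sum_eq_0)
  have "finite ?A" unfolding A by simp
  then have sumA: "(\<Sum>i | i < n \<and> j \<in> prev_window r i. weight n r i) = sum (weight n r) ?A"
    by (rule sum.mono_neutral_left) (use zero in \<open>blast intro: leI\<close>)+
  \<comment> \<open>This sum is \<open>g_num n (Suc r) (j + 2)\<close> without its leading
    1.\<close>
  have shift: "sum (weight n r) {r..j + r} = (\<Sum>l=2..j+2. fib_sum r (n - l))"
    by (rule sum.reindex_bij_witness[where i="\<lambda>l. l + r - 2" and j="\<lambda>i. i + 2 - r"])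
       (use r in \<open>auto simp: weight_def intro!: arg_cong[where f="fib_sum r"]\<close>)
  consider "r \<le> Suc j" | "j + 2 = r" | "j + 2 < r" by linarith
  then show ?thesis
  proof cases
    case 1
    then have "sum (weight n r) ?A = (\<Sum>l=1..r. fib_sum r (n + r - 2 - j - l))"
      unfolding A using r
      by (intro sum.reindex_bij_witness[where i="\<lambda>l. l + j" and j="\<lambda>i. i - j"])
         (auto simp: weight_def intro!: arg_cong[where f="fib_sum r"])
    moreover have "weight n r j = 1 + (\<Sum>l=1..r. fib_sum r (n + r - 2 - j - l))"
      using 1 r j unfolding weight_def by (subst fib_sum_rec) auto
    ultimately show ?thesis using sumA by simp
  next
    case 2
    then have "?A = insert (Suc j) {r..j + r}" unfolding A by auto
    then have "sum (weight n r) ?A = weight n r (Suc j) + sum (weight n r) {r..j + r}"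
      using 2 by simp
    also have "sum (weight n r) {r..j + r} = (\<Sum>l=2..r. fib_sum r (n - l))"
      using shift unfolding 2 .
    also have "weight n r (Suc j) = fib_sum r (n - 1)"
      using 2 by (auto simp: weight_def intro!: arg_cong[where f="fib_sum r"])
    also have "fib_sum r (n - 1) + (\<Sum>l=2..r. fib_sum r (n - l)) = (\<Sum>l=1..r. fib_sum r (n - l))"
      using r by (subst (2) sum.atLeast_Suc_atMost) (auto simp: numeral_2_eq_2)
    also have "1 + \<dots> = fib_sum r n"
      using r by (subst (2) fib_sum_rec) auto
    also have "fib_sum r n = weight n r j"
      using 2 by (simp add: weight_def flip: 2)
    finally show ?thesis using sumA by simp
  next
    case 3
    then have "?A = insert (Suc j) {r..j + r}" unfolding A by auto
    then have "sum (weight n r) ?A = weight n r (Suc j) + (\<Sum>l=2..j+2. fib_sum r (n - l))"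
      using shift 3 by simp
    \<comment> \<open>At the boundary \<open>j + 3 = r\<close> the weight is still given by the
      \<open>fib_sum\<close> branch; it agrees with \<open>h_num\<close> at 1, whose sum is
      empty.\<close>
    moreover have "weight n r (Suc j) = h_num n (Suc r) (r - 2 - j)"
    proof (cases "j + 3 = r")
      case True
      then have "n + r - 2 - Suc j = n" "r - 2 - j = 1" by auto
      then show ?thesis using True by (simp add: weight_def h_num_def)
    next
      case False
      then have "\<not> r \<le> Suc j + 2" "r - 1 - Suc j = r - 2 - j" using 3 by auto
      then show ?thesis by (simp add: weight_def)
    qed
    moreover have "weight n r j = h_num n (Suc r) (r - 2 - j) + g_num n (Suc r) (j + 2)"
    proof -
      have "r - 1 - j = Suc (r - 2 - j)" "Suc r - Suc (r - 2 - j) = j + 2" "1 \<le> r - 2 - j"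
        using 3 by auto
      then show ?thesis using 3 h_num_Suc[of "r - 2 - j" n "Suc r"] by (simp add: weight_def)
    qed
    ultimately show ?thesis using sumA by (simp add: g_num_def)
  qed
qed

text \<open>After swapping the double sum, the coefficient of \<open>y j\<close> is its weight minus
  the weights of all windows containing \<open>j\<close>, which is 1 by
  \<open>weight_rec\<close>.\<close>

lemma sum_weight_excess:
  assumes "2 \<le> r" "r < n"
  shows "(\<Sum>i<n. real (weight n r i) * excess r y i) = (\<Sum>i<n. y i)"
proof -
  have "(\<Sum>i<n. real (weight n r i) * sum y (prev_window r i)) =
    (\<Sum>i<n. \<Sum>j | j \<in> {..<n} \<and> j \<in> prev_window r i. real (weight n r i) * y j)"
  proof (intro sum.cong refl)
    fix i assume "i \<in> {..<n}"
    then have "{j. j \<in> {..<n} \<and> j \<in> prev_window r i} = prev_window r i"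
      by (auto simp: prev_window_def)
    then show "real (weight n r i) * sum y (prev_window r i) =
      (\<Sum>j | j \<in> {..<n} \<and> j \<in> prev_window r i. real (weight n r i) * y j)"
      by (simp add: sum_distrib_left)
  qed
  also have "\<dots> = (\<Sum>j<n. \<Sum>i | i \<in> {..<n} \<and> j \<in> prev_window r i. real (weight n r i) * y j)"
    by (rule sum.swap_restrict) auto
  also have "\<dots> = (\<Sum>j<n. (real (weight n r j) - 1) * y j)"
    using assms by (intro sum.cong refl) (simp add: weight_rec sum_distrib_right)
  finally show ?thesis
    by (simp add: excess_def right_diff_distrib sum_subtractf left_diff_distrib)
qed

text \<open>Indices from \<open>r - 2\<close> on carry the \<open>fib_sum\<close> factors in reverse
  order, smaller ones the \<open>h_num\<close> factors, also reversed. For \<open>r = 2\<close>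
  there are none of the latter.\<close>

lemma prod_weight:
  assumes r: "2 \<le> r" "r < n"
  shows "(\<Prod>i<n. weight n r i) = (\<Prod>i=r-1..n. fib_sum r i) * (\<Prod>l=2..r-1. h_num n (Suc r) l)"
proof -
  have "{..<n} = {r-2..<n} \<union> {..<r-2}" using r by auto
  then have "(\<Prod>i<n. weight n r i) = (\<Prod>i\<in>{r-2..<n} \<union> {..<r-2}. weight n r i)"
    by (rule arg_cong)
  also have "\<dots> = (\<Prod>i\<in>{r-2..<n}. weight n r i) * (\<Prod>i<r-2. weight n r i)"
    by (rule prod.union_disjoint) auto
  also have "(\<Prod>i\<in>{r-2..<n}. weight n r i) = (\<Prod>i=r-1..n. fib_sum r i)"
    by (rule prod.reindex_bij_witness[where i="\<lambda>i. n + r - 2 - i" and j="\<lambda>i. n + r - 2 - i"])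
       (use r in \<open>auto simp: weight_def\<close>)
  also have "(\<Prod>i<r-2. weight n r i) = (\<Prod>l=2..r-1. h_num n (Suc r) l)"
    by (rule prod.reindex_bij_witness[where i="\<lambda>i. r - 1 - i" and j="\<lambda>i. r - 1 - i"])
       (use r in \<open>auto simp: weight_def\<close>)
  finally show ?thesis .
qed

section \<open>The exponential integral\<close>

lemma borel_measurable_indicator_pred:
  assumes [measurable]: "Measurable.pred M P"
  shows "(indicator {x. P x} :: _ \<Rightarrow> ennreal) \<in> borel_measurable M"
  by measurable

lemma pred_no_polygon [measurable (raw)]:
  assumes "\<And>i. i < n \<Longrightarrow> (\<lambda>x. L x i) \<in> borel_measurable M"
  shows "Measurable.pred M (\<lambda>x. no_polygon n k (L x))"
proof -
  have "Measurable.pred M (\<lambda>x. \<not> can_form_polygon (L x) S)" if "S \<subseteq> {0..<n}" for S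
  proof -
    have S: "i < n" if "i \<in> S" for i using that \<open>S \<subseteq> {0..<n}\<close> by auto
    have fS: "finite S" using that finite_subset by blast
    show ?thesis
      unfolding can_form_polygon_def not_less[symmetric]
      by (intro pred_intros_logic pred_intros_finite fS borel_measurable_pred_less
          borel_measurable_sum assms S) auto
  qed
  then have "Measurable.pred M (\<lambda>x. \<forall>S\<in>{S. S \<subseteq> {0..<n} \<and> card S = k}. \<not> can_form_polygon (L x) S)"
    by (intro pred_intros_finite) auto
  then show ?thesis by (simp add: no_polygon_def)
qed

text \<open>The set $N$ of the opening explanation.\<close>

definition pos_no_polygon :: "nat \<Rightarrow> nat \<Rightarrow> (nat \<Rightarrow> real) \<Rightarrow> bool" where
  "pos_no_polygon n k y \<longleftrightarrow> (\<forall>i<n. 0 < y i) \<and> no_polygon n k y"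

lemma pred_pos_no_polygon [measurable (raw)]:
  assumes "\<And>i. i < n \<Longrightarrow> (\<lambda>x. L x i) \<in> borel_measurable M"
  shows "Measurable.pred M (\<lambda>x. pos_no_polygon n k (L x))"
proof -
  have "Measurable.pred M (\<lambda>x. \<forall>i\<in>{..<n}. 0 < L x i)"
    using assms by (intro pred_intros_finite borel_measurable_pred_less) auto
  moreover have "Measurable.pred M (\<lambda>x. no_polygon n k (L x))"
    using assms by (rule pred_no_polygon)
  ultimately have "Measurable.pred M (\<lambda>x. (\<forall>i\<in>{..<n}. 0 < L x i) \<and> no_polygon n k (L x))"
    by (rule pred_intros_logic)
  then show ?thesis unfolding pos_no_polygon_def Ball_def lessThan_iff .
qed

lemma pos_no_polygon_cong:
  assumes "\<And>i. i < n \<Longrightarrow> L i = L' i"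
  shows "pos_no_polygon n k L \<longleftrightarrow> pos_no_polygon n k L'"
  unfolding pos_no_polygon_def using no_polygon_cong[of n L L'] assms by auto

lemma pos_no_polygon_scale:
  "0 < c \<Longrightarrow> pos_no_polygon n k (\<lambda>i. c * L i) \<longleftrightarrow> pos_no_polygon n k L"
  by (simp add: pos_no_polygon_def no_polygon_scale zero_less_mult_iff)

lemma pos_no_polygon_permute:
  assumes \<sigma>: "\<sigma> permutes {..<n}"
  shows "pos_no_polygon n k (y \<circ> \<sigma>) \<longleftrightarrow> pos_no_polygon n k y"
proof -
  have "(\<forall>i\<in>{..<n}. 0 < y (\<sigma> i)) \<longleftrightarrow> (\<forall>i\<in>\<sigma> ` {..<n}. 0 < y i)" by simp
  also have "\<sigma> ` {..<n} = {..<n}" using \<sigma> by (rule permutes_image)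
  finally show ?thesis
    using no_polygon_permute[OF \<sigma>] by (simp add: pos_no_polygon_def Ball_def)
qed

text \<open>Scaling by \<open>c\<close> reduces to the exponential density; the endpoint is null.
  Both half-lines occur because the first \<open>r\<close> excesses are positive and the others
  nonnegative.\<close>

lemma nn_integral_exp_half_line:
  assumes c: "0 < (c :: real)" and A: "A = {0<..} \<or> A = {0..}"
  shows "(\<integral>\<^sup>+t. ennreal (exp (- (c * t))) * indicator A t \<partial>lborel) = ennreal (1 / c)"
proof -
  let ?I = "\<lambda>A. \<integral>\<^sup>+t. ennreal (exp (- (c * t))) * indicator A t \<partial>lborel"
  have "1 = (\<integral>\<^sup>+x. ennreal (exp (- x)) * indicator {0..} x \<partial>lborel)"
    using nn_intergal_power_times_exp_Ici[of 0] by simp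
  also have "\<dots> = ennreal c * (\<integral>\<^sup>+t. ennreal (exp (- (c * t))) * indicator {0..} (c * t) \<partial>lborel)"
    using c by (subst nn_integral_real_affine[where c=c and t=0]) auto
  also have "(\<integral>\<^sup>+t. ennreal (exp (- (c * t))) * indicator {0..} (c * t) \<partial>lborel) = ?I {0..}"
    using c by (intro nn_integral_cong) (simp add: indicator_def zero_le_mult_iff)
  finally have "ennreal (1 / c) = ennreal (1 / c) * ennreal c * ?I {0..}"
    by (simp add: mult.assoc)
  also have "ennreal (1 / c) * ennreal c = 1"
    using c by (simp flip: ennreal_mult')
  finally have "?I {0..} = ennreal (1 / c)" by simp
  moreover have "?I {0<..} = ?I {0..}"
    by (rule nn_integral_cong_AE, rule eventually_mono[OF AE_lborel_singleton[of 0]])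
       (auto simp: indicator_def)
  ultimately show ?thesis using A by auto
qed

text \<open>One of the two evaluations of $I$: symmetry reduces to increasing vectors, and in excess
  coordinates the integrand is a product of functions of one variable.\<close>

lemma nn_integral_pos_no_polygon_weights:
  assumes r: "2 \<le> r" "r < n"
  shows "(\<integral>\<^sup>+y. indicator {y. pos_no_polygon n (Suc r) y} y * ennreal (exp (- (\<Sum>i<n. y i))) \<partial>lborel_seq n) =
    fact n * ennreal (1 / real (\<Prod>i<n. weight n r i))"
proof -
  define f where "f y = indicator {y. pos_no_polygon n (Suc r) y} y * ennreal (exp (- (\<Sum>i<n. y i)))"
    for y :: "nat \<Rightarrow> real"
  define A where "A i = (if i < r then {0<..} else {0 :: real..})" for i
  define h where "h i t = ennreal (exp (- (real (weight n r i) * t))) * indicator (A i) t" for i t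
  have h: "h i \<in> borel_measurable lborel" for i
    unfolding h_def A_def by measurable
  have fm: "f \<in> borel_measurable (lborel_seq n)"
    unfolding f_def by measurable
  have sym: "f (y \<circ> \<sigma>) = f y" if "\<sigma> permutes {..<n}" for \<sigma> y
    using pos_no_polygon_permute[OF that] sum.permute[OF that, of y] by (simp add: f_def indicator_def)
  have eq: "f y * indicator {y. strict_mono_on {..<n} y} y =
    (\<Prod>i<n. h i ((\<lambda>i\<in>{..<n}. 1 * y i + - sum (restrict y {..<i}) (prev_window r i)) i))" for y
  proof -
    have "(\<lambda>i\<in>{..<n}. 1 * y i + - sum (restrict y {..<i}) (prev_window r i)) i = excess r y i"
      if "i < n" for i
    proof -
      have "sum (restrict y {..<i}) (prev_window r i) = sum y (prev_window r i)"
        by (rule sum.cong) (auto simp: prev_window_def)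
      then show ?thesis using that by (simp add: excess_def)
    qed
    then have "(\<Prod>i<n. h i ((\<lambda>i\<in>{..<n}. 1 * y i + - sum (restrict y {..<i}) (prev_window r i)) i)) =
      (\<Prod>i<n. h i (excess r y i))" by (intro prod.cong) auto
    also have "\<dots> = (\<Prod>i<n. ennreal (exp (- (real (weight n r i) * excess r y i)))) *
       (\<Prod>i<n. indicator (A i) (excess r y i))"
      unfolding h_def by (rule prod.distrib)
    also have "(\<Prod>i<n. ennreal (exp (- (real (weight n r i) * excess r y i)))) =
       ennreal (exp (- (\<Sum>i<n. y i)))"
      \<comment> \<open>The total length becomes a weighted sum of excesses, so its exponential
        factors.\<close>
      by (subst sum_weight_excess[OF r, symmetric], subst prod_ennreal)
         (simp_all flip: exp_sum sum_negf)
    also have "(\<Prod>i<n. indicator (A i) (excess r y i)) =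
      (if \<forall>i<n. excess r y i \<in> A i then 1 else 0 :: ennreal)"
      by (auto simp: indicator_def)
    also have "(\<forall>i<n. excess r y i \<in> A i) \<longleftrightarrow>
        strict_mono_on {..<n} y \<and> pos_no_polygon n (Suc r) y"
      using sorted_no_polygon_iff_excess[OF r(1), of n y] by (auto simp: A_def pos_no_polygon_def)
    finally show ?thesis by (auto simp: f_def indicator_def)
  qed
  have "(\<integral>\<^sup>+y. f y \<partial>lborel_seq n) =
    fact n * (\<integral>\<^sup>+y. f y * indicator {y. strict_mono_on {..<n} y} y \<partial>lborel_seq n)"
    by (rule nn_integral_lborel_seq_symmetric[OF fm sym])
  also have "(\<integral>\<^sup>+y. f y * indicator {y. strict_mono_on {..<n} y} y \<partial>lborel_seq n) =
     (\<integral>\<^sup>+z. (\<Prod>i<n. h i (z i)) \<partial>lborel_seq n)"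
  proof -
    \<comment> \<open>The excess map is triangular with unit diagonal: it subtracts from
      \<open>y i\<close> a sum of earlier entries.\<close>
    have "(\<integral>\<^sup>+z. (\<Prod>i<n. h i (z i)) \<partial>lborel_seq n) = ennreal (\<Prod>i<n. \<bar>1\<bar>) *
      (\<integral>\<^sup>+y. (\<Prod>i<n. h i ((\<lambda>i\<in>{..<n}. 1 * y i + - sum (restrict y {..<i}) (prev_window r i)) i)) \<partial>lborel_seq n)"
    proof (rule nn_integral_lborel_seq_triangular)
      show "(\<lambda>y. - sum y (prev_window r i)) \<in> borel_measurable (lborel_seq i)" for i
        by (intro borel_measurable_uminus borel_measurable_sum borel_measurable_lborel_seq_component)
           (auto simp: prev_window_def)
      show "(\<lambda>z. \<Prod>i<n. h i (z i)) \<in> borel_measurable (lborel_seq n)"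
        by (intro borel_measurable_prod_ennreal measurable_compose[OF _ h[unfolded measurable_lborel2]]
            borel_measurable_lborel_seq_component) auto
    qed auto
    then show ?thesis by (simp only: eq) simp
  qed
  also have "\<dots> = (\<Prod>i<n. \<integral>\<^sup>+t. h i t \<partial>lborel)"
    by (rule lborel_seq.product_nn_integral_prod) (use h in auto)
  also have "\<dots> = (\<Prod>i<n. ennreal (1 / real (weight n r i)))"
    unfolding h_def using weight_pos[OF r]
    by (intro prod.cong refl nn_integral_exp_half_line) (auto simp: A_def)
  also have "\<dots> = ennreal (1 / real (\<Prod>i<n. weight n r i))"
    by (simp add: prod_ennreal prod_dividef)
  finally show ?thesis by (simp add: f_def)
qed

section \<open>Gaps between partial sums or cut points\<close>

definition gap :: "(nat \<Rightarrow> real) \<Rightarrow> nat \<Rightarrow> real" where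
  "gap s i = s i - (if i = 0 then 0 else s (i - 1))"

lemma sum_gap: "(\<Sum>i<Suc m. gap s i) = s m"
  by (induction m) (auto simp: gap_def)

text \<open>The update \<open>x(m := 1)\<close> appends the right end of the stick, and
  \<open>gap\<close> takes the left end 0 as predecessor of the first cut. Positive gaps thus
  express the chain \<open>0 < x 0 < ... < x (m - 1) < 1\<close>.\<close>

lemma gap_pos_iff:
  "(\<forall>i<Suc m. 0 < gap (x(m := 1)) i) \<longleftrightarrow> strict_mono_on {..<m} x \<and> (\<forall>i<m. 0 < x i \<and> x i < 1)"
  if "0 < m"
proof
  assume gap: "\<forall>i<Suc m. 0 < gap (x(m := 1)) i"
  have "i \<le> m \<Longrightarrow> 0 < (x(m := 1)) i \<and> (\<forall>j<i. (x(m := 1)) j < (x(m := 1)) i)" for i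
  proof (induction i)
    case 0
    then show ?case using gap by (auto simp: gap_def)
  next
    case (Suc i)
    then have "(x(m := 1)) i < (x(m := 1)) (Suc i)"
      using gap[rule_format, of "Suc i"] by (simp add: gap_def)
    then show ?case using Suc by (force simp: less_Suc_eq)
  qed
  note * = this
  show "strict_mono_on {..<m} x \<and> (\<forall>i<m. 0 < x i \<and> x i < 1)"
  proof (intro conjI allI impI strict_mono_onI)
    show "x i < x j" if "i \<in> {..<m}" "j \<in> {..<m}" "i < j" for i j
      using *[of j] that by auto
    show "0 < x i" "x i < 1" if "i < m" for i
      using *[of i] *[of m] that by auto
  qed
next
  assume x: "strict_mono_on {..<m} x \<and> (\<forall>i<m. 0 < x i \<and> x i < 1)"
  show "\<forall>i<Suc m. 0 < gap (x(m := 1)) i"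
  proof (intro allI impI)
    fix i assume "i < Suc m"
    then show "0 < gap (x(m := 1)) i"
      using x by (cases i) (auto simp: gap_def strict_mono_on_def)
  qed
qed

lemma borel_measurable_gap_upd:
  assumes "i \<le> m"
  shows "(\<lambda>x. gap (x(m := t)) i) \<in> borel_measurable (lborel_seq m)"
proof -
  have "(\<lambda>x. (x(m := t)) j) \<in> borel_measurable (lborel_seq m)" if "j \<le> m" for j
    using that by (cases "j = m") auto
  from this[of i] this[of "i - 1"] assms show ?thesis
    unfolding gap_def by (cases "i = 0") (simp_all del: fun_upd_apply)
qed

text \<open>
  The last partial sum \<open>t\<close> is the length of the stick; rescaling the others by \<open>t\<close> produces the
  factor \<open>t ^ m\<close>, and $\int_0^\infty t^m e^{-t}\,dt = m!$.
\<close>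

lemma nn_integral_pos_no_polygon_gaps:
  assumes m: "0 < m"
  shows "(\<integral>\<^sup>+y. indicator {y. pos_no_polygon (Suc m) k y} y * ennreal (exp (- (\<Sum>i<Suc m. y i))) \<partial>lborel_seq (Suc m)) =
    fact m * (\<integral>\<^sup>+x. indicator {x. pos_no_polygon (Suc m) k (gap (x(m := 1)))} x \<partial>lborel_seq m)"
proof -
  let ?N = "pos_no_polygon (Suc m) k"
  \<comment> \<open>\<open>K t\<close> is the volume of the increasing cut vectors of a stick of
    length \<open>t\<close> that allow no polygon.\<close>
  define K where "K t = (\<integral>\<^sup>+x. indicator {x. ?N (gap (x(m := t)))} x \<partial>lborel_seq m)" for t
  have ind: "(indicator {x. ?N (gap (x(m := t)))} :: _ \<Rightarrow> ennreal) \<in> borel_measurable (lborel_seq m)" for t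
    by (intro borel_measurable_indicator_pred pred_pos_no_polygon borel_measurable_gap_upd) auto
  define f where "f y = indicator {y. ?N y} y * ennreal (exp (- (\<Sum>i<Suc m. y i)))"
    for y :: "nat \<Rightarrow> real"
  have fm: "f \<in> borel_measurable (lborel_seq (Suc m))"
    unfolding f_def
    by (intro borel_measurable_times_ennreal borel_measurable_indicator_pred pred_pos_no_polygon) auto
  define g where "g s = indicator {s. ?N (gap s)} s * ennreal (exp (- s m))"
    for s :: "nat \<Rightarrow> real"
  have gapm: "(\<lambda>s. gap s i) \<in> borel_measurable (lborel_seq (Suc m))" if "i < Suc m" for i
    using that by (cases "i = 0") (auto simp: gap_def)
  have gm: "g \<in> borel_measurable (lborel_seq (Suc m))"
    unfolding g_def
    by (intro borel_measurable_times_ennreal borel_measurable_indicator_pred pred_pos_no_polygon gapm)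
       auto
  \<comment> \<open>With unit diagonal this shift maps partial sums to their gaps.\<close>
  define \<phi> where "\<phi> i s = (if i = 0 then 0 else - s (i - 1) :: real)" for i and s :: "nat \<Rightarrow> real"
  have "(\<integral>\<^sup>+y. f y \<partial>lborel_seq (Suc m)) = ennreal (\<Prod>i<Suc m. \<bar>1\<bar>) *
    (\<integral>\<^sup>+s. f (\<lambda>i\<in>{..<Suc m}. 1 * s i + \<phi> i (restrict s {..<i})) \<partial>lborel_seq (Suc m))"
  proof (rule nn_integral_lborel_seq_triangular)
    show "\<phi> i \<in> borel_measurable (lborel_seq i)" for i
      unfolding \<phi>_def by (cases "i = 0") auto
  qed (use fm in auto)
  also have "\<dots> = (\<integral>\<^sup>+s. g s \<partial>lborel_seq (Suc m))"
  proof -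
    have "f (\<lambda>i\<in>{..<Suc m}. 1 * s i + \<phi> i (restrict s {..<i})) = g s" for s
    proof -
      define z where "z = (\<lambda>i\<in>{..<Suc m}. 1 * s i + \<phi> i (restrict s {..<i}))"
      have z: "z i = gap s i" if "i < Suc m" for i
        using that by (simp add: z_def \<phi>_def gap_def)
      have "?N z \<longleftrightarrow> ?N (gap s)" by (rule pos_no_polygon_cong[OF z])
      moreover have "(\<Sum>i<Suc m. z i) = s m"
        by (rule trans[OF sum.cong[OF refl z] sum_gap]) simp
      ultimately have "f z = g s"
        by (simp only: f_def g_def indicator_def mem_Collect_eq)
      then show ?thesis by (simp only: z_def)
    qed
    then show ?thesis by (simp only: abs_one prod.neutral_const ennreal_1 mult_1)
  qed
  also have "\<dots> = (\<integral>\<^sup>+t. (\<integral>\<^sup>+x. g (x(m := t)) \<partial>lborel_seq m) \<partial>lborel)"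
    using gm unfolding lessThan_Suc by (subst lborel_seq.product_nn_integral_insert_rev) auto
  also have "\<dots> = (\<integral>\<^sup>+t. ennreal (t ^ m * exp (- t)) * indicator {0..} t * K 1 \<partial>lborel)"
  proof (rule nn_integral_cong)
    fix t :: real
    have "(\<integral>\<^sup>+x. g (x(m := t)) \<partial>lborel_seq m) =
      (\<integral>\<^sup>+x. ennreal (exp (- t)) * indicator {x. ?N (gap (x(m := t)))} x \<partial>lborel_seq m)"
      by (simp add: g_def indicator_def mult.commute)
    also have "\<dots> = ennreal (exp (- t)) * K t"
      unfolding K_def by (rule nn_integral_cmult[OF ind])
    also have "\<dots> = ennreal (t ^ m * exp (- t)) * indicator {0..} t * K 1"
    proof (cases "0 < t")
      case True
      \<comment> \<open>Triangular substitution with diagonal \<open>t\<close> and zero shift, whose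
        Jacobian is \<open>t ^ m\<close>.\<close>
      have "K t = ennreal (\<Prod>i<m. \<bar>t\<bar>) * (\<integral>\<^sup>+x. indicator {x. ?N (gap (x(m := t)))}
          (\<lambda>i\<in>{..<m}. t * x i + 0) \<partial>lborel_seq m)"
        unfolding K_def using True ind by (intro nn_integral_lborel_seq_triangular) auto
      also have "(\<integral>\<^sup>+x. indicator {x. ?N (gap (x(m := t)))} (\<lambda>i\<in>{..<m}. t * x i + 0) \<partial>lborel_seq m) = K 1"
      proof -
        have "?N (gap ((\<lambda>i\<in>{..<m}. t * x i + 0)(m := t))) \<longleftrightarrow> ?N (gap (x(m := 1)))" for x
        proof -
          have "?N (gap ((\<lambda>i\<in>{..<m}. t * x i + 0)(m := t))) \<longleftrightarrow> ?N (\<lambda>i. t * gap (x(m := 1)) i)"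
            by (rule pos_no_polygon_cong) (auto simp: gap_def algebra_simps)
          then show ?thesis using pos_no_polygon_scale[OF True] by simp
        qed
        then show ?thesis by (simp add: K_def indicator_def)
      qed
      finally show ?thesis
        using True by (simp add: ennreal_mult' mult_ac)
    next
      case False
      \<comment> \<open>Positive gaps cannot have the sum \<open>t \<le> 0\<close>. On the other
        side, \<open>t = 0\<close> lies in the half-line, but there \<open>t ^ m\<close> vanishes
        since \<open>m\<close> is positive.\<close>
      have "\<not> ?N (gap (x(m := t)))" for x
      proof
        assume "?N (gap (x(m := t)))"
        then have "0 < (\<Sum>i<Suc m. gap (x(m := t)) i)"
          by (intro sum_pos) (auto simp: pos_no_polygon_def)
        then show False unfolding sum_gap using False by simp
      qed
      then have "K t = 0" by (simp add: K_def)
      then show ?thesis using False m by (simp add: indicator_def)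
    qed
    finally show "(\<integral>\<^sup>+x. g (x(m := t)) \<partial>lborel_seq m) =
      ennreal (t ^ m * exp (- t)) * indicator {0..} t * K 1" .
  qed
  also have "\<dots> = (\<integral>\<^sup>+t. ennreal (t ^ m * exp (- t)) * indicator {0..} t \<partial>lborel) * K 1"
    by (rule nn_integral_multc) simp
  also have "\<dots> = fact m * K 1"
    by (subst nn_intergal_power_times_exp_Ici)
       (metis ennreal_of_nat_eq_real_of_nat of_nat_fact)
  finally show ?thesis by (simp add: f_def K_def)
qed

section \<open>The broken stick\<close>

text \<open>Density and indicator of the box are both products over the coordinates, so Tonelli
  applies. This identifies a product density with a product measure.\<close>

lemma emeasure_density_PiE:
  fixes g :: "real \<Rightarrow> ennreal"
  assumes [measurable]: "g \<in> borel_measurable borel" and A: "\<And>i. i < n \<Longrightarrow> A i \<in> sets borel"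
  shows "emeasure (density (lborel_seq n) (\<lambda>x. \<Prod>i<n. g (x i))) (Pi\<^sub>E {..<n} A) =
    (\<Prod>i<n. emeasure (density lborel g) (A i))"
proof -
  have "(\<lambda>x. \<Prod>i<n. g (x i)) \<in> borel_measurable (lborel_seq n)"
    by (intro borel_measurable_prod_ennreal measurable_compose[OF _ assms(1)]
        borel_measurable_lborel_seq_component) auto
  moreover have "Pi\<^sub>E {..<n} A \<in> sets (lborel_seq n)"
    using A by (intro sets_PiM_I_finite) auto
  ultimately have "emeasure (density (lborel_seq n) (\<lambda>x. \<Prod>i<n. g (x i))) (Pi\<^sub>E {..<n} A) =
    (\<integral>\<^sup>+x. (\<Prod>i<n. g (x i)) * indicator (Pi\<^sub>E {..<n} A) x \<partial>lborel_seq n)"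
    by (rule emeasure_density)
  also have "\<dots> = (\<integral>\<^sup>+x. (\<Prod>i<n. g (x i) * indicator (A i) (x i)) \<partial>lborel_seq n)"
  proof (rule nn_integral_cong)
    fix x assume "x \<in> space (lborel_seq n)"
    then have "x \<in> extensional {..<n}" by (simp add: space_PiM PiE_def)
    then have "x \<in> Pi\<^sub>E {..<n} A \<longleftrightarrow> (\<forall>i\<in>{..<n}. x i \<in> A i)"
      by (auto simp: PiE_def Pi_def)
    moreover have "(\<Prod>i<n. indicator (A i) (x i)) = (if \<forall>i\<in>{..<n}. x i \<in> A i then 1 else 0 :: ennreal)"
      by (auto simp: indicator_def)
    ultimately have "indicator (Pi\<^sub>E {..<n} A) x = (\<Prod>i<n. indicator (A i) (x i) :: ennreal)"
      by (simp add: indicator_def)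
    then show "(\<Prod>i<n. g (x i)) * indicator (Pi\<^sub>E {..<n} A) x =
      (\<Prod>i<n. g (x i) * indicator (A i) (x i))"
      by (simp add: prod.distrib)
  qed
  also have "\<dots> = (\<Prod>i<n. \<integral>\<^sup>+t. g t * indicator (A i) t \<partial>lborel)"
    using A by (intro lborel_seq.product_nn_integral_prod) auto
  also have "\<dots> = (\<Prod>i<n. emeasure (density lborel g) (A i))"
    using A by (intro prod.cong) (auto simp: emeasure_density)
  finally show ?thesis .
qed

text \<open>The endpoints are null; the open interval fits the strict inequalities of
  \<open>gap_pos_iff\<close>.\<close>

lemma uniform_unit_eq_density:
  "uniform_measure lborel {0..1::real} = density lborel (indicator {0<..<1})"
  unfolding uniform_measure_def
proof (rule density_cong)
  show "AE x in lborel. indicator {0..1::real} x / emeasure lborel {0..1::real} = indicator {0<..<1} x"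
    using AE_lborel_singleton[of "0::real"] AE_lborel_singleton[of "1::real"]
    by eventually_elim (auto simp: indicator_def)
qed auto

lemma borel_measurable_prod_indicator_unit:
  "(\<lambda>x. \<Prod>i<n. indicator {0<..<1} (x i) :: ennreal) \<in> borel_measurable (lborel_seq n)"
proof -
  have "(indicator {0<..<1} :: real \<Rightarrow> ennreal) \<in> borel_measurable borel" by measurable
  from measurable_compose[OF _ this] show ?thesis
    by (intro borel_measurable_prod_ennreal) auto
qed

lemma map_pred_upt: "map (\<lambda>i. x (i - 1)) [1..<Suc m] = map x [0..<m]"
  by (rule nth_equalityI) (auto simp del: upt_Suc)

text \<open>The sorted cuts followed by 1 list the values of
  \<open>(x \<circ> \<sigma>)(m := 1)\<close>; the leading 0 of \<open>cut_positions\<close> is the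
  one built into \<open>gap\<close>.\<close>

lemma segment_length_sorting_permutation:
  fixes x :: "nat \<Rightarrow> real"
  assumes "\<sigma> permutes {..<m}" "mono_on {..<m} (x \<circ> \<sigma>)" "i < Suc m"
  shows "segment_length (Suc m) (\<lambda>i. x (i - 1)) i = gap ((x \<circ> \<sigma>)(m := 1)) i"
proof -
  have cut: "cut_positions (Suc m) (\<lambda>i. x (i - 1)) = 0 # map (x \<circ> \<sigma>) [0..<m] @ [1]"
    unfolding cut_positions_def by (simp only: map_pred_upt sort_map_eq_if_mono_on[OF assms(1,2)])
  have nth: "(map (x \<circ> \<sigma>) [0..<m] @ [1]) ! j = ((x \<circ> \<sigma>)(m := 1)) j" if "j \<le> m" for j
    using that by (auto simp: nth_append)
  show ?thesis
    unfolding segment_length_def cut gap_def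
    using nth[of i] nth[of "i - 1"] assms(3) by (cases i) (auto simp del: fun_upd_apply)
qed

text \<open>The stick is cut at \<open>x 0, \<dots>, x (m - 1)\<close>, in contrast to the numbering from \<open>1\<close> in \<open>cut_positions\<close>.\<close>

definition cuts_no_polygon :: "nat \<Rightarrow> nat \<Rightarrow> (nat \<Rightarrow> real) \<Rightarrow> bool" where
  "cuts_no_polygon m k x \<longleftrightarrow> no_polygon (Suc m) k (segment_length (Suc m) (\<lambda>i. x (i - 1)))"

lemma cuts_no_polygon_sorting_permutation:
  assumes "\<sigma> permutes {..<m}" "mono_on {..<m} (x \<circ> \<sigma>)"
  shows "cuts_no_polygon m k x \<longleftrightarrow> no_polygon (Suc m) k (gap ((x \<circ> \<sigma>)(m := 1)))"
  unfolding cuts_no_polygon_def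
  by (rule no_polygon_cong, rule segment_length_sorting_permutation[OF assms])

lemma cuts_no_polygon_permute:
  assumes "\<sigma> permutes {..<m}"
  shows "cuts_no_polygon m k (x \<circ> \<sigma>) \<longleftrightarrow> cuts_no_polygon m k x"
proof -
  have "sort (map (x \<circ> \<sigma>) [0..<m]) = sort (map x [0..<m])"
    by (rule properties_for_sort) (simp_all only: mset_sort mset_map_permute[OF assms] sorted_sort)
  then have "cut_positions (Suc m) (\<lambda>i. (x \<circ> \<sigma>) (i - 1)) = cut_positions (Suc m) (\<lambda>i. x (i - 1))"
    unfolding cut_positions_def map_pred_upt by (simp only:)
  then have "segment_length (Suc m) (\<lambda>i. (x \<circ> \<sigma>) (i - 1)) = segment_length (Suc m) (\<lambda>i. x (i - 1))"
    by (simp add: segment_length_def fun_eq_iff)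
  then show ?thesis by (simp add: cuts_no_polygon_def)
qed

lemma pred_mono_on_lborel_seq:
  "Measurable.pred (lborel_seq n) (mono_on {..<n})"
proof -
  have eq: "mono_on {..<n} x \<longleftrightarrow> (\<forall>i\<in>{..<n}. \<forall>j\<in>{i..<n}. \<not> x j < x i)" for x :: "nat \<Rightarrow> real"
    by (auto simp: monotone_on_def not_less)
  show ?thesis
    unfolding eq[abs_def]
    by (intro pred_intros_finite pred_intros_logic borel_measurable_pred_less) auto
qed

text \<open>
  Sorting is not directly accessible to the measurability prover, so the event is written as a finite
  union over all possible sorting permutations.
\<close>

lemma pred_cuts_no_polygon:
  "Measurable.pred (lborel_seq m) (cuts_no_polygon m k)"
proof -
  have eq: "cuts_no_polygon m k x \<longleftrightarrow> (\<exists>\<sigma>\<in>{\<sigma>. \<sigma> permutes {..<m}}.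
      mono_on {..<m} (x \<circ> \<sigma>) \<and> no_polygon (Suc m) k (gap ((x \<circ> \<sigma>)(m := 1))))" for x
    using cuts_no_polygon_sorting_permutation[of _ m x k] sorting_permutation_exists[of m x]
    by (metis mem_Collect_eq)
  have sorted: "Measurable.pred (lborel_seq m) (\<lambda>x. mono_on {..<m} x \<and> no_polygon (Suc m) k (gap (x(m := 1))))"
    by (intro pred_intros_logic pred_mono_on_lborel_seq pred_no_polygon borel_measurable_gap_upd) auto
  show ?thesis
    unfolding eq[abs_def]
    by (intro pred_intros_finite finite_permutations measurable_compose[OF measurable_permute_lborel_seq sorted])
       auto
qed

text \<open>The right-hand side is that of \<open>nn_integral_pos_no_polygon_gaps\<close>, so the
  probability equals $I$. Here \<open>fact m\<close> counts the orders of the cut points, there it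
  is a Gamma integral.\<close>

lemma nn_integral_uniform_cuts_no_polygon:
  assumes m: "0 < m"
  shows "(\<integral>\<^sup>+x. (\<Prod>i<m. indicator {0<..<1} (x i)) * indicator {x. cuts_no_polygon m k x} x \<partial>lborel_seq m) =
    fact m * (\<integral>\<^sup>+x. indicator {x. pos_no_polygon (Suc m) k (gap (x(m := 1)))} x \<partial>lborel_seq m)"
proof -
  define f :: "(nat \<Rightarrow> real) \<Rightarrow> ennreal"
    where "f x = (\<Prod>i<m. indicator {0<..<1} (x i)) * indicator {x. cuts_no_polygon m k x} x" for x
  \<comment> \<open>On increasing \<open>x\<close> the identity sorts; for all other
    \<open>x\<close> some gap is not positive and both sides vanish.\<close>
  have sorted: "f x * indicator {x. strict_mono_on {..<m} x} x =
    indicator {x. pos_no_polygon (Suc m) k (gap (x(m := 1)))} x" for x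
  proof (cases "strict_mono_on {..<m} x")
    case True
    then have "cuts_no_polygon m k x \<longleftrightarrow> no_polygon (Suc m) k (gap (x(m := 1)))"
      using cuts_no_polygon_sorting_permutation[of id m x k] by (simp add: strict_mono_on_imp_mono_on permutes_id)
    moreover have "(\<Prod>i<m. indicator {0<..<1} (x i) :: ennreal) = (if \<forall>i<m. 0 < x i \<and> x i < 1 then 1 else 0)"
      by (auto simp: indicator_def)
    ultimately show ?thesis
      using True gap_pos_iff[OF m, of x] by (simp add: f_def indicator_def pos_no_polygon_def)
  next
    case False
    then show ?thesis
      using gap_pos_iff[OF m, of x] by (auto simp: indicator_def pos_no_polygon_def)
  qed
  have "(\<integral>\<^sup>+x. f x \<partial>lborel_seq m) =
    fact m * (\<integral>\<^sup>+x. f x * indicator {x. strict_mono_on {..<m} x} x \<partial>lborel_seq m)"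
  proof (rule nn_integral_lborel_seq_symmetric)
    show "f \<in> borel_measurable (lborel_seq m)"
      unfolding f_def
      by (intro borel_measurable_times_ennreal borel_measurable_indicator_pred pred_cuts_no_polygon
          borel_measurable_prod_indicator_unit)
    show "f (x \<circ> \<sigma>) = f x" if "\<sigma> permutes {..<m}" for \<sigma> x
      using cuts_no_polygon_permute[OF that, of k x]
        prod.permute[OF that, of "\<lambda>i. indicator {0<..<1} (x i) :: ennreal"]
      by (simp add: f_def indicator_def o_def)
  qed
  also have "(\<integral>\<^sup>+x. f x * indicator {x. strict_mono_on {..<m} x} x \<partial>lborel_seq m) =
    (\<integral>\<^sup>+x. indicator {x. pos_no_polygon (Suc m) k (gap (x(m := 1)))} x \<partial>lborel_seq m)"
    by (simp only: sorted)
  finally show ?thesis by (simp only: f_def)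
qed

text \<open>Both measures are compared on boxes with the product of uniform measures: the joint law
  by independence, the density by \<open>emeasure_density_PiE\<close>.\<close>

lemma (in prob_space) distr_uniform_lborel_seq:
  assumes indep: "indep_vars (\<lambda>_. borel) X {1..<Suc m}"
    and unif: "\<And>i. i \<in> {1..<Suc m} \<Longrightarrow> distr M lborel (X i) = uniform_measure lborel {0..1}"
    and m: "0 < m"
  shows "distr M (lborel_seq m) (\<lambda>\<omega>. \<lambda>i\<in>{..<m}. X (Suc i) \<omega>) =
    density (lborel_seq m) (\<lambda>x. \<Prod>i<m. indicator {0<..<1} (x i))"
proof -
  have X: "X (Suc i) \<in> borel_measurable M" if "i < m" for i
    using indep that by (auto simp: indep_vars_def)
  have Xm: "(\<lambda>\<omega>. \<lambda>i\<in>{..<m}. X (Suc i) \<omega>) \<in> M \<rightarrow>\<^sub>M lborel_seq m"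
    by (intro measurable_restrict) (use X in auto)
  let ?U = "uniform_measure lborel {0..1::real}"
  interpret U: product_sigma_finite "\<lambda>_::nat. ?U"
    unfolding product_sigma_finite_def
    by (intro allI prob_space_imp_sigma_finite prob_space_uniform_measure) auto
  have "distr M (lborel_seq m) (\<lambda>\<omega>. \<lambda>i\<in>{..<m}. X (Suc i) \<omega>) = PiM {..<m} (\<lambda>_. ?U)"
  proof (rule U.PiM_eqI)
    fix A :: "nat \<Rightarrow> real set" assume "\<And>i. i \<in> {..<m} \<Longrightarrow> A i \<in> sets ?U"
    then have A: "\<And>i. i < m \<Longrightarrow> A i \<in> sets borel" by simp
    have "emeasure (distr M (lborel_seq m) (\<lambda>\<omega>. \<lambda>i\<in>{..<m}. X (Suc i) \<omega>)) (Pi\<^sub>E {..<m} A) =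
      emeasure M ((\<lambda>\<omega>. \<lambda>i\<in>{..<m}. X (Suc i) \<omega>) -` Pi\<^sub>E {..<m} A \<inter> space M)"
      using A by (intro emeasure_distr[OF Xm] sets_PiM_I_finite) auto
    \<comment> \<open>The variables are numbered from 1 and the coordinates from 0, hence
      \<open>A (j - 1)\<close>.\<close>
    also have "(\<lambda>\<omega>. \<lambda>i\<in>{..<m}. X (Suc i) \<omega>) -` Pi\<^sub>E {..<m} A \<inter> space M =
      (\<Inter>j\<in>{1..<Suc m}. X j -` A (j - 1) \<inter> space M)"
    proof (intro set_eqI iffI)
      fix \<omega> assume "\<omega> \<in> (\<lambda>\<omega>. \<lambda>i\<in>{..<m}. X (Suc i) \<omega>) -` Pi\<^sub>E {..<m} A \<inter> space M"
      then have "\<omega> \<in> space M" and *: "\<And>i. i < m \<Longrightarrow> X (Suc i) \<omega> \<in> A i"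
        by (auto simp: PiE_iff)
      moreover have "X j \<omega> \<in> A (j - 1)" if "j \<in> {1..<Suc m}" for j
        using *[of "j - 1"] that by (cases j) auto
      ultimately show "\<omega> \<in> (\<Inter>j\<in>{1..<Suc m}. X j -` A (j - 1) \<inter> space M)" by simp
    next
      fix \<omega> assume *: "\<omega> \<in> (\<Inter>j\<in>{1..<Suc m}. X j -` A (j - 1) \<inter> space M)"
      have "X (Suc i) \<omega> \<in> A i" if "i < m" for i
        using INT_D[OF *, of "Suc i"] that by simp
      \<comment> \<open>Some index must exist for the intersection to be confined to
        \<open>space M\<close>; this is where \<open>0 < m\<close> enters.\<close>
      moreover have "\<omega> \<in> space M" using INT_D[OF *, of 1] m by simp
      ultimately show "\<omega> \<in> (\<lambda>\<omega>. \<lambda>i\<in>{..<m}. X (Suc i) \<omega>) -` Pi\<^sub>E {..<m} A \<inter> space M"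
        by (auto simp: PiE_iff)
    qed
    also have "emeasure M (\<Inter>j\<in>{1..<Suc m}. X j -` A (j - 1) \<inter> space M) =
      ennreal (\<Prod>j\<in>{1..<Suc m}. prob (X j -` A (j - 1) \<inter> space M))"
      unfolding emeasure_eq_measure using m A
      by (subst indep_varsD[OF indep, where J="{1..<Suc m}" and A="\<lambda>j. A (j - 1)"]) auto
    also have "\<dots> = (\<Prod>j\<in>{1..<Suc m}. emeasure M (X j -` A (j - 1) \<inter> space M))"
      unfolding emeasure_eq_measure by (rule prod_ennreal[symmetric]) simp
    also have "\<dots> = (\<Prod>i<m. emeasure M (X (Suc i) -` A i \<inter> space M))"
      by (rule prod.reindex_bij_witness[where i=Suc and j="\<lambda>j. j - 1"]) auto
    also have "\<dots> = (\<Prod>i<m. emeasure ?U (A i))"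
    proof (intro prod.cong refl)
      fix i assume "i \<in> {..<m}"
      then have "emeasure (distr M lborel (X (Suc i))) (A i) = emeasure M (X (Suc i) -` A i \<inter> space M)"
        using X A by (intro emeasure_distr) auto
      then show "emeasure M (X (Suc i) -` A i \<inter> space M) = emeasure ?U (A i)"
        using unif[of "Suc i"] \<open>i \<in> {..<m}\<close> by simp
    qed
    finally show "emeasure (distr M (lborel_seq m) (\<lambda>\<omega>. \<lambda>i\<in>{..<m}. X (Suc i) \<omega>)) (Pi\<^sub>E {..<m} A) =
      (\<Prod>i<m. emeasure ?U (A i))" .
  qed (auto intro!: sets_PiM_cong)
  also have "PiM {..<m} (\<lambda>_. ?U) = density (lborel_seq m) (\<lambda>x. \<Prod>i<m. indicator {0<..<1} (x i))"
  proof (rule U.PiM_eqI[symmetric])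
    fix A :: "nat \<Rightarrow> real set" assume "\<And>i. i \<in> {..<m} \<Longrightarrow> A i \<in> sets ?U"
    then show "emeasure (density (lborel_seq m) (\<lambda>x. \<Prod>i<m. indicator {0<..<1} (x i))) (Pi\<^sub>E {..<m} A) =
      (\<Prod>i<m. emeasure ?U (A i))"
      unfolding uniform_unit_eq_density by (intro emeasure_density_PiE) auto
  qed (auto intro!: sets_PiM_cong)
  finally show ?thesis .
qed

theorem theorem2:
  fixes M :: "'a measure" and X :: "nat \<Rightarrow> 'a \<Rightarrow> real" and n k :: nat
  assumes "3 \<le> k" and "k \<le> n"
    and "prob_space M"
    and "prob_space.indep_vars M (\<lambda>_. borel) X {1..<n}"
    and "\<And>i. i \<in> {1..<n} \<Longrightarrow> distr M lborel (X i) = uniform_measure lborel {0..1}"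
  shows "\<P>(\<omega> in M. \<forall>S. S \<subseteq> {0..<n} \<and> card S = k \<longrightarrow>
            \<not> can_form_polygon (segment_length n (\<lambda>i. X i \<omega>)) S)
         = fact n / (real (\<Prod>i=k-2..n. fib_sum (k - 1) i) * real (\<Prod>l=2..k-2. h_num n k l))"
proof -
  interpret prob_space M by fact
  \<comment> \<open>There are \<open>m\<close> cut points for \<open>m + 1\<close> segments; below,
    \<open>r = k - 1\<close> is the order of the Fibonacci recursion.\<close>
  obtain m where n: "n = Suc m" using assms(1,2) by (cases n) auto
  obtain r where k: "k = Suc r" using assms(1) by (cases k) auto
  have m: "0 < m" and r: "2 \<le> r" "r < n" using assms(1,2) n k by auto
  have indep: "indep_vars (\<lambda>_. borel) X {1..<Suc m}" using assms(4) n by simp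
  let ?Y = "\<lambda>\<omega>. \<lambda>i\<in>{..<m}. X (Suc i) \<omega>"
  let ?g = "\<lambda>x. \<Prod>i<m. indicator {0<..<1} (x i) :: ennreal"
  have event: "(\<forall>S. S \<subseteq> {0..<n} \<and> card S = k \<longrightarrow>
      \<not> can_form_polygon (segment_length n (\<lambda>i. X i \<omega>)) S) \<longleftrightarrow> cuts_no_polygon m k (?Y \<omega>)" for \<omega>
  proof -
    have "map (\<lambda>i. ?Y \<omega> (i - 1)) [1..<Suc m] = map (\<lambda>i. X i \<omega>) [1..<Suc m]" by auto
    then have "cut_positions (Suc m) (\<lambda>i. ?Y \<omega> (i - 1)) = cut_positions (Suc m) (\<lambda>i. X i \<omega>)"
      unfolding cut_positions_def by (simp only:)
    then have "segment_length (Suc m) (\<lambda>i. ?Y \<omega> (i - 1)) = segment_length (Suc m) (\<lambda>i. X i \<omega>)"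
      unfolding segment_length_def by (simp only:)
    then show ?thesis unfolding cuts_no_polygon_def no_polygon_def n by (simp only:)
  qed
  have Ym: "?Y \<in> M \<rightarrow>\<^sub>M lborel_seq m"
    by (intro measurable_restrict) (use indep in \<open>auto simp: indep_vars_def\<close>)
  have gm: "?g \<in> borel_measurable (lborel_seq m)"
    by (rule borel_measurable_prod_indicator_unit)
  let ?E = "{x \<in> space (lborel_seq m). cuts_no_polygon m k x}"
  have E: "?E \<in> sets (lborel_seq m)"
    using pred_cuts_no_polygon by (simp add: pred_def)
  have "emeasure M {\<omega> \<in> space M. cuts_no_polygon m k (?Y \<omega>)} = emeasure (distr M (lborel_seq m) ?Y) ?E"
    using measurable_space[OF Ym]
    by (subst emeasure_distr[OF Ym E]) (auto intro!: arg_cong[where f="emeasure M"])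
  also have "\<dots> = emeasure (density (lborel_seq m) ?g) ?E"
    using distr_uniform_lborel_seq[OF indep _ m] assms(5) n by simp
  also have "\<dots> = (\<integral>\<^sup>+x. ?g x * indicator ?E x \<partial>lborel_seq m)"
    by (rule emeasure_density[OF gm E])
  also have "\<dots> = (\<integral>\<^sup>+x. ?g x * indicator {x. cuts_no_polygon m k x} x \<partial>lborel_seq m)"
    by (intro nn_integral_cong) (simp add: indicator_def)
  \<comment> \<open>The probability and $I$ share the value \<open>fact m\<close> times the volume
    of increasing cuts; rewriting one into the other leaves the evaluation of $I$ by
    weights.\<close>
  also have "\<dots> = fact n * ennreal (1 / real (\<Prod>i<n. weight n r i))"
    unfolding nn_integral_uniform_cuts_no_polygon[OF m] nn_integral_pos_no_polygon_gaps[OF m, symmetric]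
    using nn_integral_pos_no_polygon_weights[OF r] unfolding n k .
  also have "\<dots> = ennreal (fact n / real (\<Prod>i<n. weight n r i))"
    by (metis divide_inverse ennreal_mult' ennreal_of_nat_eq_real_of_nat fact_ge_zero inverse_eq_divide of_nat_fact)
  finally have "prob {\<omega> \<in> space M. cuts_no_polygon m k (?Y \<omega>)} = fact n / real (\<Prod>i<n. weight n r i)"
    by (simp add: measure_def del: of_nat_prod)
  also have "(\<Prod>i<n. weight n r i) = (\<Prod>i=k-2..n. fib_sum (k - 1) i) * (\<Prod>l=2..k-2. h_num n k l)"
    using prod_weight[OF r] by (simp add: k numeral_2_eq_2)
  finally show ?thesis
    unfolding event by (simp only: of_nat_mult)
qed

end
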